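(* Let $k$ be a field, $n\ge2$, $Q=k[x_{i,j}\mid1\le i\le n,\ 1\le j\le n+1]$, and $R=Q/I_n$, where $I_n$ is the ideal of maximal minors of the generic $n\times(n+1)$ matrix $X=(x_{i,j})$. A minimal generating set for $\operatorname{Der}_{R\mid k}$ over $R$ is $$\mathcal M=\{V_{r,s},\,B_\ell,\,L_{i,j}\},$$ where $r,s\in\{1,\dots,n\}$ with $r\ne s$, $\ell\in\{2,\dots,n\}$, and $i,j\in\{1,\dots,n+1\}$.
   Context: $\operatorname{Der}_{R\mid k}$ is the $R$-module of $k$-linear maps $\delta:R\to R$ satisfying $\delta(ab)=\delta(a)b+a\delta(b)$. The following derivations of $Q$ are regarded as elements of $\operatorname{Der}_{R\mid k}$ via the derivations they induce on $R$: $$V_{r,s}=\sum_{u=1}^{n+1}x_{r,u}\frac{\partial}{\partial x_{s,u}},\qquad B_\ell=-V_{1,1}+V_{\ell,\ell},$$ $$L_{i,j}=(-1)^j\sum_{k=1}^nx_{k,j}\frac{\partial}{\partial x_{k,i}}\ (i\ne j),\qquad L_{i,i}=(-1)^{i+1}\Big(\sum_{k\in\{1,\dots,n+1\},\,k\ne i}x_{1,k}\frac{\partial}{\partial x_{1,k}}-\sum_{\ell=2}^{n}x_{\ell,i}\frac{\partial}{\partial x_{\ell,i}}\Big).$$ *)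

theory Defs
  imports
    "HOL-Library.Poly_Mapping"
    "HOL-Library.FuncSet"
    "HOL-Algebra.QuotRing"
    "HOL-Algebra.Module"
    "Jordan_Normal_Form.Determinant"
    "Jordan_Normal_Form.DL_Submatrix"
    "Jordan_Normal_Form.Missing_VectorSpace"
begin

section \<open>Polynomial rings\<close>

text \<open>A polynomial maps each exponent vector to its coefficient.\<close>

type_synonym ('v, 'k) mpol = "('v \<Rightarrow>\<^sub>0 nat) \<Rightarrow>\<^sub>0 'k"

definition Const :: "'k::comm_ring_1 \<Rightarrow> ('v, 'k) mpol"
  where "Const c = Poly_Mapping.single 0 c"

definition Var :: "'v \<Rightarrow> ('v, 'k::comm_ring_1) mpol"
  where "Var v = Poly_Mapping.single (Poly_Mapping.single v 1) 1"

definition mpoly_ring :: "'v set \<Rightarrow> ('v, 'k::comm_ring_1) mpol ring"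
  where "mpoly_ring W =
    \<lparr>carrier = {p. \<forall>m \<in> Poly_Mapping.keys p. Poly_Mapping.keys m \<subseteq> W},
     monoid.mult = (*), one = 1, zero = 0, add = (+)\<rparr>"

text \<open>Partial derivative. In a monomial \<open>m\<close> that does not involve \<open>v\<close> the truncated
  subtraction of exponents is harmless, because the coefficient \<open>of_nat 0\<close> kills the term.\<close>

definition partial_deriv :: "'v \<Rightarrow> ('v, 'k::comm_ring_1) mpol \<Rightarrow> ('v, 'k) mpol"
  where "partial_deriv v p =
    (\<Sum>m \<in> Poly_Mapping.keys p.
      Poly_Mapping.single (m - Poly_Mapping.single v 1)
        (of_nat (Poly_Mapping.lookup m v) * Poly_Mapping.lookup p m))"


section \<open>The module of derivations of an algebra\<close>

text \<open>A \<open>k\<close>-algebra is a commutative ring \<open>A\<close> with a structure map \<open>\<eta>\<close> from \<open>k\<close>;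
  the scalar \<open>c\<close> acts as multiplication by \<open>\<eta> c\<close>. Maps out of \<open>carrier A\<close> are
  \<open>undefined\<close> outside it, so that equality of derivations is equality on \<open>carrier A\<close>.\<close>

definition derivations :: "('a, 'b) ring_scheme \<Rightarrow> ('k \<Rightarrow> 'a) \<Rightarrow> ('a \<Rightarrow> 'a) set"
  where "derivations A \<eta> =
    {\<delta> \<in> carrier A \<rightarrow>\<^sub>E carrier A.
      (\<forall>a \<in> carrier A. \<forall>b \<in> carrier A. \<delta> (a \<oplus>\<^bsub>A\<^esub> b) = \<delta> a \<oplus>\<^bsub>A\<^esub> \<delta> b) \<and>
      (\<forall>c. \<forall>a \<in> carrier A. \<delta> (\<eta> c \<otimes>\<^bsub>A\<^esub> a) = \<eta> c \<otimes>\<^bsub>A\<^esub> \<delta> a) \<and>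
      (\<forall>a \<in> carrier A. \<forall>b \<in> carrier A.
        \<delta> (a \<otimes>\<^bsub>A\<^esub> b) = \<delta> a \<otimes>\<^bsub>A\<^esub> b \<oplus>\<^bsub>A\<^esub> a \<otimes>\<^bsub>A\<^esub> \<delta> b)}"

text \<open>The fields \<open>mult\<close> and \<open>one\<close> exist only because the record type of modules extends
  that of rings; they play no role for a module.\<close>

definition Der :: "('a, 'b) ring_scheme \<Rightarrow> ('k \<Rightarrow> 'a) \<Rightarrow> ('a, 'a \<Rightarrow> 'a) module"
  where "Der A \<eta> =
    \<lparr>carrier = derivations A \<eta>, monoid.mult = undefined, one = undefined,
     zero = (\<lambda>a \<in> carrier A. \<zero>\<^bsub>A\<^esub>),
     add = (\<lambda>\<delta> \<epsilon>. \<lambda>a \<in> carrier A. \<delta> a \<oplus>\<^bsub>A\<^esub> \<epsilon> a),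
     module.smult = (\<lambda>r \<delta>. \<lambda>a \<in> carrier A. r \<otimes>\<^bsub>A\<^esub> \<delta> a)\<rparr>"

definition minimal_generating_set ::
    "('a, 'b) ring_scheme \<Rightarrow> ('a, 'm, 'c) module_scheme \<Rightarrow> 'm set \<Rightarrow> bool"
  where "minimal_generating_set A M S \<longleftrightarrow>
    S \<subseteq> carrier M \<and>
    LinearCombinations.module.span A M S = carrier M \<and>
    (\<forall>T. T \<subset> S \<longrightarrow> LinearCombinations.module.span A M T \<noteq> carrier M)"

text \<open>The map induced by \<open>D\<close> on the quotient \<open>A Quot I\<close>. If \<open>D\<close> is additive and maps \<open>I\<close>
  into \<open>I\<close>, all cosets in the union coincide. If they do not coincide, the union is not a
  single coset, and the result does not map into \<open>A Quot I\<close>.\<close>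

definition induced_map :: "('a, 'b) ring_scheme \<Rightarrow> 'a set \<Rightarrow> ('a \<Rightarrow> 'a) \<Rightarrow> 'a set \<Rightarrow> 'a set"
  where "induced_map A I D = (\<lambda>C \<in> carrier (A Quot I). \<Union>f \<in> C. I +>\<^bsub>A\<^esub> D f)"


section \<open>The generic determinantal ring of maximal minors\<close>

type_synonym 'k xpol = "(nat \<times> nat, 'k) mpol"

abbreviation xv :: "nat \<Rightarrow> nat \<Rightarrow> 'k::field xpol"
  where "xv i j \<equiv> Var (i, j)"

definition Q_ring :: "nat \<Rightarrow> 'k::field xpol ring"
  where "Q_ring n = mpoly_ring ({1..n} \<times> {1..n+1})"

text \<open>Matrix entries are indexed from 0, the variables from 1.\<close>

definition X_mat :: "nat \<Rightarrow> 'k::field xpol mat"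
  where "X_mat n = mat n (n+1) (\<lambda>(i, j). xv (i+1) (j+1))"

text \<open>For matrices with at least as many columns as rows.\<close>

definition maximal_minors :: "'a::comm_ring_1 mat \<Rightarrow> 'a set"
  where "maximal_minors A =
    {det (submatrix A UNIV J) | J. J \<subseteq> {..<dim_col A} \<and> card J = dim_row A}"

definition I_ideal :: "nat \<Rightarrow> 'k::field xpol set"
  where "I_ideal n = Idl\<^bsub>Q_ring n\<^esub> (maximal_minors (X_mat n))"

definition R_ring :: "nat \<Rightarrow> 'k::field xpol set ring"
  where "R_ring n = Q_ring n Quot I_ideal n"

definition R_const :: "nat \<Rightarrow> 'k::field \<Rightarrow> 'k xpol set"
  where "R_const n c = I_ideal n +>\<^bsub>Q_ring n\<^esub> Const c"

definition Der_R :: "nat \<Rightarrow> ('k::field xpol set, 'k xpol set \<Rightarrow> 'k xpol set) module"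
  where "Der_R n = Der (R_ring n) (R_const n)"

definition induced_R :: "nat \<Rightarrow> ('k::field xpol \<Rightarrow> 'k xpol) \<Rightarrow> 'k xpol set \<Rightarrow> 'k xpol set"
  where "induced_R n = induced_map (Q_ring n) (I_ideal n)"


section \<open>The derivations of the polynomial ring\<close>

definition V_der :: "nat \<Rightarrow> nat \<Rightarrow> nat \<Rightarrow> 'k::field xpol \<Rightarrow> 'k xpol"
  where "V_der n r s f = (\<Sum>u = 1..n+1. xv r u * partial_deriv (s, u) f)"

definition B_der :: "nat \<Rightarrow> nat \<Rightarrow> 'k::field xpol \<Rightarrow> 'k xpol"
  where "B_der n l f = - V_der n 1 1 f + V_der n l l f"

definition L_der :: "nat \<Rightarrow> nat \<Rightarrow> nat \<Rightarrow> 'k::field xpol \<Rightarrow> 'k xpol"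
  where "L_der n i j f =
    (if i = j
     then (-1) ^ (i+1) *
       ((\<Sum>k \<in> {1..n+1} - {i}. xv 1 k * partial_deriv (1, k) f)
        - (\<Sum>l = 2..n. xv l i * partial_deriv (l, i) f))
     else (-1) ^ j * (\<Sum>k = 1..n. xv k j * partial_deriv (k, i) f))"

end

theory Submission
  imports Defs
begin

text \<open>
  A derivation of \<open>R\<close> lifts to a vector field \<open>D\<close> on affine space that maps \<open>I\<^sub>n\<close> into itself;
  it is determined by the matrix \<open>A = D(X)\<close> of its values on the variables. Let \<open>\<Delta>\<close> be the column
  vector of signed maximal minors, so that \<open>X \<Delta> = 0\<close>. Since \<open>D\<close> preserves \<open>I\<^sub>n\<close>, there is a square
  matrix \<open>T\<close> over \<open>Q\<close> with \<open>D(\<Delta>) = T \<Delta>\<close>, and differentiating \<open>X \<Delta> = 0\<close> gives \<open>(A + X T) \<Delta> = 0\<close>.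
  By the Hilbert--Burch theorem every syzygy of the minors is a combination of the rows of \<open>X\<close>
  (\<open>syzygy_in_row_space\<close>), hence \<open>A = P X - X T\<close>: the lift is a \<open>Q\<close>-combination of the
  infinitesimal row and column operations on \<open>X\<close>. Conversely such a field preserves \<open>I\<^sub>n\<close>, because it
  gives \<open>X (D(\<Delta>) - T \<Delta>) = 0\<close> and the kernel of \<open>X\<close> consists of the multiples of \<open>\<Delta>\<close>
  (\<open>kernel_multiple_of_minors\<close>).

  Both exactness statements come from the adjugate of the square matrix obtained by putting a row on
  top of \<open>X\<close>, together with one arithmetic fact: two of the minors are coprime. For the
  weight \<open>i j\<close> of \<open>x\<^bsub>i,j\<^esub>\<close>, the minors without the last and without the first column have the leading
  monomials \<open>x\<^bsub>1,1\<^esub> \<dots> x\<^bsub>n,n\<^esub>\<close> and \<open>x\<^bsub>1,2\<^esub> \<dots> x\<^bsub>n,n+1\<^esub>\<close> by the rearrangement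
  inequality, and these involve different variables (\<open>coprime_leading_monomials\<close>).

  The row and column operations are combinations of the elements of \<open>\<M>\<close>. The only point is the Euler field
  \<open>V\<^bsub>1,1\<^esub>\<close> of the first row. All row Euler fields together have the same sum as all column Euler
  fields, and as there is one more column than rows, this expresses \<open>V\<^bsub>1,1\<^esub>\<close> by the \<open>B\<^sub>l\<close> and \<open>L\<^bsub>i,i\<^esub>\<close>
  with coefficients \<open>1\<close> and \<open>-1\<close>, in every characteristic (\<open>euler_identity\<close>).

  For minimality, \<open>I\<^sub>n\<close> has no terms of degree less than two because \<open>n \<ge> 2\<close>, so the linear parts of
  the values on the variables are well defined for a derivation of \<open>R\<close>. Each element of \<open>\<M>\<close> is
  separated from all the others by a functional on these linear parts, a sum of a few entries of the
  coefficient matrix (\<open>dual_functional\<close>); the derivations with linear values on which this functional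
  vanishes generate a proper submodule.
\<close>

section \<open>Polynomial rings\<close>

lemma carrier_mpoly_ring:
  "p \<in> carrier (mpoly_ring W) \<longleftrightarrow> (\<forall>m \<in> Poly_Mapping.keys p. Poly_Mapping.keys m \<subseteq> W)"
  by (simp add: mpoly_ring_def)

lemma mpoly_ring_simps [simp]:
  "monoid.mult (mpoly_ring W) = (*)" "monoid.one (mpoly_ring W) = 1"
  "ring.zero (mpoly_ring W) = 0" "ring.add (mpoly_ring W) = (+)"
  by (simp_all add: mpoly_ring_def)

lemma mpoly_zero_closed [simp]: "0 \<in> carrier (mpoly_ring W)"
  and mpoly_Const_closed [simp]: "Const c \<in> carrier (mpoly_ring W)"
  and mpoly_one_closed [simp]: "1 \<in> carrier (mpoly_ring W)"
  and mpoly_Var_closed [simp]: "v \<in> W \<Longrightarrow> Var v \<in> carrier (mpoly_ring W)"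
  by (auto simp: carrier_mpoly_ring Const_def Var_def)

lemma mpoly_add_closed [simp]:
  "\<lbrakk>p \<in> carrier (mpoly_ring W); q \<in> carrier (mpoly_ring W)\<rbrakk> \<Longrightarrow> p + q \<in> carrier (mpoly_ring W)"
  using keys_add[of p q] by (auto simp: carrier_mpoly_ring)

lemma mpoly_uminus_closed [simp]:
  "p \<in> carrier (mpoly_ring W) \<Longrightarrow> - p \<in> carrier (mpoly_ring W)"
  by (auto simp: carrier_mpoly_ring in_keys_iff)

lemma mpoly_diff_closed [simp]:
  "\<lbrakk>p \<in> carrier (mpoly_ring W); q \<in> carrier (mpoly_ring W)\<rbrakk> \<Longrightarrow> p - q \<in> carrier (mpoly_ring W)"
  using mpoly_add_closed[of p W "- q"] by simp

lemma mpoly_mult_closed [simp]: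
  assumes "p \<in> carrier (mpoly_ring W)" "q \<in> carrier (mpoly_ring W)"
  shows "p * q \<in> carrier (mpoly_ring W)"
  unfolding carrier_mpoly_ring
proof
  fix m assume "m \<in> Poly_Mapping.keys (p * q)"
  then obtain a b where "m = a + b" "a \<in> Poly_Mapping.keys p" "b \<in> Poly_Mapping.keys q"
    using keys_mult[of p q] by blast
  then show "Poly_Mapping.keys m \<subseteq> W"
    using assms keys_add[of a b] unfolding carrier_mpoly_ring by blast
qed

lemma mpoly_sum_closed [simp]:
  "(\<And>i. i \<in> F \<Longrightarrow> f i \<in> carrier (mpoly_ring W)) \<Longrightarrow> sum f F \<in> carrier (mpoly_ring W)"
  by (induction F rule: infinite_finite_induct) auto

lemma mpoly_sign_closed [simp]: "(-1) ^ i * p \<in> carrier (mpoly_ring W) \<longleftrightarrow> p \<in> carrier (mpoly_ring W)"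
  using mpoly_uminus_closed[of p W] mpoly_uminus_closed[of "- p" W]
  by (cases "even i") auto

lemma cring_mpoly_ring: "cring (mpoly_ring W)"
proof (rule cringI)
  show "abelian_group (mpoly_ring W)"
  proof (rule abelian_groupI)
    fix x assume "x \<in> carrier (mpoly_ring W)"
    then show "\<exists>y \<in> carrier (mpoly_ring W). y \<oplus>\<^bsub>mpoly_ring W\<^esub> x = \<zero>\<^bsub>mpoly_ring W\<^esub>"
      by (intro bexI[of _ "- x"]) auto
  qed (auto simp: algebra_simps)
  show "comm_monoid (mpoly_ring W)"
    by (rule comm_monoidI) (auto simp: algebra_simps)
qed (auto simp: algebra_simps)

lemma a_minus_mpoly_ring:
  assumes "p \<in> carrier (mpoly_ring W)" "q \<in> carrier (mpoly_ring W)"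
  shows "p \<ominus>\<^bsub>mpoly_ring W\<^esub> q = p - q"
proof -
  interpret cring "mpoly_ring W" by (rule cring_mpoly_ring)
  have "\<ominus>\<^bsub>mpoly_ring W\<^esub> q = - q"
    by (rule minus_equality) (use assms in auto)
  then show ?thesis by (simp add: a_minus_def)
qed

lemma sum_monomials: "p = (\<Sum>m \<in> Poly_Mapping.keys p. Poly_Mapping.single m (Poly_Mapping.lookup p m))"
  by (rule poly_mapping_eqI)
    (auto simp: lookup_sum lookup_single when_def in_keys_iff sum.delta)

lemma poly_mapping_additive_induct [case_names zero single add]:
  fixes p :: "'a \<Rightarrow>\<^sub>0 'b::comm_monoid_add"
  assumes "P 0" "\<And>m c. m \<in> Poly_Mapping.keys p \<Longrightarrow> P (Poly_Mapping.single m c)"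
    "\<And>f g. P f \<Longrightarrow> P g \<Longrightarrow> P (f + g)"
  shows "P p"
proof -
  have "P (\<Sum>m \<in> F. Poly_Mapping.single m (Poly_Mapping.lookup p m))"
    if "F \<subseteq> Poly_Mapping.keys p" for F
    using finite_subset[OF that finite_keys] that
    by (induction rule: finite_induct) (auto intro: assms)
  from this[of "Poly_Mapping.keys p"] show ?thesis by (simp flip: sum_monomials)
qed

lemma single_eq_Const_mult: "Poly_Mapping.single m c = Const c * Poly_Mapping.single m 1"
  by (simp add: Const_def mult_single)

lemma Const_zero: "Const 0 = 0"
  by (simp add: Const_def)

text \<open>
  The coefficient of the monomial is \<open>1\<close>, so that the induction builds it from
  \<open>1\<close> one variable at a time.
\<close>

lemma monomial_induct [case_names one Var]:
  fixes P :: "('v, 'k::comm_ring_1) mpol \<Rightarrow> bool"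
  assumes "P 1" "\<And>f v. v \<in> Poly_Mapping.keys m \<Longrightarrow> P f \<Longrightarrow> P (Var v * f)"
  shows "P (Poly_Mapping.single m 1)"
  using assms(2)
proof (induction "\<Sum>v \<in> Poly_Mapping.keys m. Poly_Mapping.lookup m v" arbitrary: m)
  case 0
  then have "m = 0" by (auto simp: in_keys_iff intro!: poly_mapping_eqI)
  then show ?case using assms(1) by simp
next
  case (Suc N)
  then obtain v where v: "v \<in> Poly_Mapping.keys m"
    by (metis Zero_not_Suc all_not_in_conv sum.empty)
  define m' where "m' = m - Poly_Mapping.single v (1::nat)"
  have m: "m = Poly_Mapping.single v 1 + m'"
    using v by (intro poly_mapping_eqI)
      (auto simp: m'_def lookup_add lookup_minus lookup_single when_def in_keys_iff)
  have sub: "Poly_Mapping.keys m' \<subseteq> Poly_Mapping.keys m"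
    by (auto simp: m'_def lookup_minus in_keys_iff)
  have "(\<Sum>u \<in> Poly_Mapping.keys m'. Poly_Mapping.lookup m' u)
      = (\<Sum>u \<in> Poly_Mapping.keys m. Poly_Mapping.lookup m' u)"
    using sub by (intro sum.mono_neutral_left) (auto simp: in_keys_iff)
  moreover have "(\<Sum>u \<in> Poly_Mapping.keys m. Poly_Mapping.lookup m u)
      = (\<Sum>u \<in> Poly_Mapping.keys m. (if u = v then 1 else 0) + Poly_Mapping.lookup m' u)"
    by (intro sum.cong) (auto simp: m lookup_add lookup_single when_def)
  ultimately have "N = (\<Sum>u \<in> Poly_Mapping.keys m'. Poly_Mapping.lookup m' u)"
    using Suc.hyps(2) v by (simp add: sum.distrib)
  then have "P (Poly_Mapping.single m' 1)"
    using Suc.hyps(1) Suc.prems sub by blast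
  then have "P (Var v * Poly_Mapping.single m' 1)" by (rule Suc.prems[OF v])
  then show ?case by (subst m) (simp add: Var_def mult_single)
qed

lemma mpoly_ring_induct [consumes 1, case_names Const Var add]:
  fixes f :: "('v, 'k::comm_ring_1) mpol"
  assumes "f \<in> carrier (mpoly_ring W)"
    and "\<And>c. P (Const c)"
    and "\<And>f v. \<lbrakk>v \<in> W; f \<in> carrier (mpoly_ring W); P f\<rbrakk> \<Longrightarrow> P (Var v * f)"
    and "\<And>f g. \<lbrakk>f \<in> carrier (mpoly_ring W); g \<in> carrier (mpoly_ring W); P f; P g\<rbrakk> \<Longrightarrow> P (f + g)"
  shows "P f"
proof -
  have "f \<in> carrier (mpoly_ring W) \<and> P f"
  proof (induction f rule: poly_mapping_additive_induct)
    case zero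
    then show ?case using assms(2)[of 0] by (simp add: Const_zero)
  next
    case (single m c)
    then have W: "Poly_Mapping.keys m \<subseteq> W" using assms(1) by (simp add: carrier_mpoly_ring)
    have "Const c * Poly_Mapping.single m 1 \<in> carrier (mpoly_ring W)
        \<and> P (Const c * Poly_Mapping.single m 1)"
    proof (induction rule: monomial_induct)
      case one
      show ?case using assms(2)[of c] by simp
    next
      case (Var f v)
      then have "Var v * (Const c * f) \<in> carrier (mpoly_ring W) \<and> P (Var v * (Const c * f))"
        using W assms(3)[of v "Const c * f"] mpoly_mult_closed[of "Var v" W "Const c * f"] by auto
      then show ?case by (simp add: ac_simps)
    qed
    then show ?case by (simp flip: single_eq_Const_mult)
  next
    case (add f g)
    then show ?case using assms(4) by simp
  qed
  then show ?thesis ..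
qed

text \<open>
  Divisibility arguments below take place among polynomials in all variables. The retraction that
  drops every monomial with a variable outside \<open>W\<close> brings quotients back to
  \<open>mpoly_ring W\<close>; it is linear over that subring, so it preserves equations between
  linear combinations with coefficients there.
\<close>

definition restrict_vars :: "'v set \<Rightarrow> ('v, 'k::comm_ring_1) mpol \<Rightarrow> ('v, 'k) mpol"
  where "restrict_vars W p =
    (\<Sum>m \<in> {m \<in> Poly_Mapping.keys p. Poly_Mapping.keys m \<subseteq> W}. Poly_Mapping.single m (Poly_Mapping.lookup p m))"

lemma lookup_restrict_vars:
  "Poly_Mapping.lookup (restrict_vars W p) m = (if Poly_Mapping.keys m \<subseteq> W then Poly_Mapping.lookup p m else 0)"
  by (auto simp: restrict_vars_def lookup_sum lookup_single when_def in_keys_iff sum.delta)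

lemma restrict_vars_closed [simp]: "restrict_vars W p \<in> carrier (mpoly_ring W)"
  unfolding carrier_mpoly_ring
proof
  fix m assume "m \<in> Poly_Mapping.keys (restrict_vars W p)"
  then have "Poly_Mapping.lookup (restrict_vars W p) m \<noteq> 0" by (simp add: in_keys_iff)
  then show "Poly_Mapping.keys m \<subseteq> W" by (simp add: lookup_restrict_vars split: if_splits)
qed

lemma restrict_vars_single:
  "restrict_vars W (Poly_Mapping.single m c) = (if Poly_Mapping.keys m \<subseteq> W then Poly_Mapping.single m c else 0)"
  by (intro poly_mapping_eqI) (auto simp: lookup_restrict_vars lookup_single when_def)

lemma restrict_vars_id: "p \<in> carrier (mpoly_ring W) \<Longrightarrow> restrict_vars W p = p"
  by (intro poly_mapping_eqI) (auto simp: carrier_mpoly_ring in_keys_iff lookup_restrict_vars)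

lemma restrict_vars_add: "restrict_vars W (p + q) = restrict_vars W p + restrict_vars W q"
  and restrict_vars_zero: "restrict_vars W 0 = 0"
  by (intro poly_mapping_eqI; simp add: lookup_restrict_vars lookup_add)+

lemma restrict_vars_sum: "restrict_vars W (sum f F) = (\<Sum>i \<in> F. restrict_vars W (f i))"
  by (induction F rule: infinite_finite_induct) (auto simp: restrict_vars_add restrict_vars_zero)

lemma keys_add_nat: "Poly_Mapping.keys (a + b) = Poly_Mapping.keys a \<union> Poly_Mapping.keys (b :: 'v \<Rightarrow>\<^sub>0 nat)"
  by (auto simp: in_keys_iff lookup_add)

lemma restrict_vars_mult:
  assumes "q \<in> carrier (mpoly_ring W)"
  shows "restrict_vars W (p * q) = restrict_vars W p * q"
proof (induction p rule: poly_mapping_additive_induct)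
  case (single m c)
  from assms show ?case
  proof (induction q rule: mpoly_ring_induct)
    case (Const d)
    show ?case
      by (simp add: restrict_vars_single Const_def mult_single)
  next
    case (Var f v)
    have shift: "restrict_vars W (Poly_Mapping.single v' 1 * g) = Poly_Mapping.single v' 1 * restrict_vars W g"
      if "Poly_Mapping.keys v' \<subseteq> W" for v' and g :: "('a, 'b) mpol"
    proof (induction g rule: poly_mapping_additive_induct)
      case (single m c)
      show ?case using that
        by (simp add: restrict_vars_single mult_single keys_add_nat)
    qed (auto simp: restrict_vars_add restrict_vars_zero algebra_simps)
    have "restrict_vars W (Poly_Mapping.single m c * (Var v * f))
        = restrict_vars W (Var v * (Poly_Mapping.single m c * f))" by (simp add: ac_simps)
    also have "\<dots> = Var v * restrict_vars W (Poly_Mapping.single m c * f)"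
      unfolding Var_def by (rule shift) (use Var in auto)
    finally show ?case using Var by (simp add: ac_simps)
  qed (auto simp: restrict_vars_add algebra_simps)
qed (auto simp: restrict_vars_add restrict_vars_zero algebra_simps)

section \<open>Vector fields on affine space\<close>

lemma lookup_partial_deriv:
  "Poly_Mapping.lookup (partial_deriv v p) m
    = of_nat (Poly_Mapping.lookup m v + 1) * Poly_Mapping.lookup p (m + Poly_Mapping.single v 1)"
proof -
  have eq: "m' - Poly_Mapping.single v 1 = m \<longleftrightarrow> m' = m + Poly_Mapping.single v 1"
    if "Poly_Mapping.lookup m' v \<noteq> 0" for m'
  proof
    assume "m' - Poly_Mapping.single v 1 = m"
    with that show "m' = m + Poly_Mapping.single v 1"
      by (intro poly_mapping_eqI) (auto simp: lookup_add lookup_minus lookup_single when_def)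
  qed simp
  have "Poly_Mapping.lookup (partial_deriv v p) m
    = (\<Sum>m' \<in> Poly_Mapping.keys p. if m' = m + Poly_Mapping.single v 1
        then of_nat (Poly_Mapping.lookup m' v) * Poly_Mapping.lookup p m' else 0)"
    unfolding partial_deriv_def lookup_sum lookup_single
  proof (rule sum.cong[OF refl])
    fix m' assume "m' \<in> Poly_Mapping.keys p"
    show "(of_nat (Poly_Mapping.lookup m' v) * Poly_Mapping.lookup p m' when m' - Poly_Mapping.single v 1 = m)
      = (if m' = m + Poly_Mapping.single v 1 then of_nat (Poly_Mapping.lookup m' v) * Poly_Mapping.lookup p m' else 0)"
      using eq[of m'] by (cases "Poly_Mapping.lookup m' v = 0") (auto simp: when_def)
  qed
  then show ?thesis by (auto simp: sum.delta in_keys_iff lookup_add)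
qed

lemma partial_deriv_add: "partial_deriv v (p + q) = partial_deriv v p + partial_deriv v q"
  and partial_deriv_zero [simp]: "partial_deriv v 0 = 0"
  by (intro poly_mapping_eqI; simp add: lookup_partial_deriv lookup_add algebra_simps)+

lemma partial_deriv_single:
  "partial_deriv v (Poly_Mapping.single m c)
    = Poly_Mapping.single (m - Poly_Mapping.single v 1) (of_nat (Poly_Mapping.lookup m v) * c)"
  by (cases "c = 0") (auto simp: partial_deriv_def)

lemma partial_deriv_Var: "partial_deriv v (Var u) = (if u = v then 1 else 0)"
  by (auto simp: Var_def partial_deriv_single lookup_single when_def)

lemma partial_deriv_Const [simp]: "partial_deriv v (Const c) = 0"
  by (simp add: Const_def partial_deriv_single)

lemma partial_deriv_mult: "partial_deriv v (p * q) = partial_deriv v p * q + p * partial_deriv v q"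
proof (induction p rule: poly_mapping_additive_induct)
  case (single m c)
  show ?case
  proof (induction q rule: poly_mapping_additive_induct)
    case (single m' c')
    let ?s = "Poly_Mapping.single v (1::nat)"
    \<comment> \<open>Subtraction of exponents is truncated, so that the two identities need the variable to occur in the factor that is differentiated.\<close>
    have 1: "m + m' - ?s = (m - ?s) + m'" if "Poly_Mapping.lookup m v \<noteq> 0"
      using that by (intro poly_mapping_eqI) (auto simp: lookup_add lookup_minus lookup_single when_def)
    have 2: "m + m' - ?s = m + (m' - ?s)" if "Poly_Mapping.lookup m' v \<noteq> 0"
      using that by (intro poly_mapping_eqI) (auto simp: lookup_add lookup_minus lookup_single when_def)
    show ?case
    proof (cases "Poly_Mapping.lookup m v = 0"; cases "Poly_Mapping.lookup m' v = 0")
      assume "Poly_Mapping.lookup m v \<noteq> 0" "Poly_Mapping.lookup m' v \<noteq> 0"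
      then have "(m - ?s) + m' = m + m' - ?s" "m + (m' - ?s) = m + m' - ?s"
        using 1 2 by auto
      then show ?thesis
        by (simp add: mult_single partial_deriv_single lookup_add single_add[symmetric] algebra_simps)
    qed (simp_all add: mult_single partial_deriv_single lookup_add 1[simplified] 2[simplified] mult.assoc mult.left_commute)
  qed (auto simp: partial_deriv_add algebra_simps)
qed (auto simp: partial_deriv_add algebra_simps)

lemma partial_deriv_closed [simp]:
  assumes "p \<in> carrier (mpoly_ring W)"
  shows "partial_deriv v p \<in> carrier (mpoly_ring W)"
  unfolding carrier_mpoly_ring
proof
  fix m assume "m \<in> Poly_Mapping.keys (partial_deriv v p)"
  then have "m + Poly_Mapping.single v 1 \<in> Poly_Mapping.keys p"
    by (auto simp: in_keys_iff lookup_partial_deriv)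
  then show "Poly_Mapping.keys m \<subseteq> W"
    using assms unfolding carrier_mpoly_ring by (metis keys_add_nat le_sup_iff)
qed

definition vector_field :: "'v set \<Rightarrow> ('v \<Rightarrow> ('v, 'k::comm_ring_1) mpol) \<Rightarrow> ('v, 'k) mpol \<Rightarrow> ('v, 'k) mpol"
  where "vector_field W A f = (\<Sum>v \<in> W. A v * partial_deriv v f)"

lemma vector_field_zero [simp]: "vector_field W A 0 = 0"
  and vector_field_Const [simp]: "vector_field W A (Const c) = 0"
  and vector_field_add: "vector_field W A (f + g) = vector_field W A f + vector_field W A g"
  and vector_field_mult: "vector_field W A (f * g) = vector_field W A f * g + f * vector_field W A g"
  by (simp_all add: vector_field_def partial_deriv_add partial_deriv_mult algebra_simps
      sum.distrib sum_distrib_left)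

lemma vector_field_sum: "vector_field W A (sum f F) = (\<Sum>i \<in> F. vector_field W A (f i))"
  by (induction F rule: infinite_finite_induct) (auto simp: vector_field_add)

lemma vector_field_Var: "finite W \<Longrightarrow> vector_field W A (Var v) = (if v \<in> W then A v else 0)"
  by (simp add: vector_field_def partial_deriv_Var if_distrib cong: if_cong)

lemma vector_field_closed [simp]:
  "\<lbrakk>A \<in> W \<rightarrow> carrier (mpoly_ring W); f \<in> carrier (mpoly_ring W)\<rbrakk>
    \<Longrightarrow> vector_field W A f \<in> carrier (mpoly_ring W)"
  unfolding vector_field_def by (intro mpoly_sum_closed mpoly_mult_closed) auto

lemma vector_field_add_coeff:
  "vector_field W (\<lambda>v. A v + B v) f = vector_field W A f + vector_field W B f"
  and vector_field_smult_coeff: "vector_field W (\<lambda>v. g * A v) f = g * vector_field W A f"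
  by (simp_all add: vector_field_def algebra_simps sum.distrib sum_distrib_left)

section \<open>Derivations of a quotient of a polynomial ring\<close>

lemma derivationsI:
  assumes "\<delta> \<in> carrier A \<rightarrow>\<^sub>E carrier A"
    and "\<And>a b. \<lbrakk>a \<in> carrier A; b \<in> carrier A\<rbrakk> \<Longrightarrow> \<delta> (a \<oplus>\<^bsub>A\<^esub> b) = \<delta> a \<oplus>\<^bsub>A\<^esub> \<delta> b"
    and "\<And>c a. a \<in> carrier A \<Longrightarrow> \<delta> (\<eta> c \<otimes>\<^bsub>A\<^esub> a) = \<eta> c \<otimes>\<^bsub>A\<^esub> \<delta> a"
    and "\<And>a b. \<lbrakk>a \<in> carrier A; b \<in> carrier A\<rbrakk>
      \<Longrightarrow> \<delta> (a \<otimes>\<^bsub>A\<^esub> b) = \<delta> a \<otimes>\<^bsub>A\<^esub> b \<oplus>\<^bsub>A\<^esub> a \<otimes>\<^bsub>A\<^esub> \<delta> b"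
  shows "\<delta> \<in> derivations A \<eta>"
  using assms by (simp add: derivations_def)

lemma derivationsD:
  assumes "\<delta> \<in> derivations A \<eta>"
  shows "\<delta> \<in> carrier A \<rightarrow>\<^sub>E carrier A"
    and "a \<in> carrier A \<Longrightarrow> \<delta> a \<in> carrier A"
    and "\<lbrakk>a \<in> carrier A; b \<in> carrier A\<rbrakk> \<Longrightarrow> \<delta> (a \<oplus>\<^bsub>A\<^esub> b) = \<delta> a \<oplus>\<^bsub>A\<^esub> \<delta> b"
    and "a \<in> carrier A \<Longrightarrow> \<delta> (\<eta> c \<otimes>\<^bsub>A\<^esub> a) = \<eta> c \<otimes>\<^bsub>A\<^esub> \<delta> a"
    and "\<lbrakk>a \<in> carrier A; b \<in> carrier A\<rbrakk>
      \<Longrightarrow> \<delta> (a \<otimes>\<^bsub>A\<^esub> b) = \<delta> a \<otimes>\<^bsub>A\<^esub> b \<oplus>\<^bsub>A\<^esub> a \<otimes>\<^bsub>A\<^esub> \<delta> b"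
  using assms by (auto simp: derivations_def)

lemma Der_simps [simp]:
  "carrier (Der A \<eta>) = derivations A \<eta>"
  "\<zero>\<^bsub>Der A \<eta>\<^esub> = (\<lambda>a \<in> carrier A. \<zero>\<^bsub>A\<^esub>)"
  "\<delta> \<oplus>\<^bsub>Der A \<eta>\<^esub> \<epsilon> = (\<lambda>a \<in> carrier A. \<delta> a \<oplus>\<^bsub>A\<^esub> \<epsilon> a)"
  "r \<odot>\<^bsub>Der A \<eta>\<^esub> \<delta> = (\<lambda>a \<in> carrier A. r \<otimes>\<^bsub>A\<^esub> \<delta> a)"
  by (simp_all add: Der_def)

lemma derivation_ext:
  assumes "\<delta> \<in> derivations A \<eta>" "\<epsilon> \<in> derivations A \<eta>"
    and "\<And>a. a \<in> carrier A \<Longrightarrow> \<delta> a = \<epsilon> a"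
  shows "\<delta> = \<epsilon>"
  using derivationsD(1)[OF assms(1)] derivationsD(1)[OF assms(2)] assms(3) by (rule PiE_ext)

lemma module_Der:
  fixes A :: "('a, 'b) ring_scheme"
  assumes "cring A" and \<eta>: "\<And>c. \<eta> c \<in> carrier A"
  shows "module A (Der A \<eta>)"
proof -
  interpret cring A by fact
  note D = derivationsD
  have zero: "(\<lambda>a \<in> carrier A. \<zero>\<^bsub>A\<^esub>) \<in> derivations A \<eta>"
    by (rule derivationsI) (auto simp: \<eta>)
  have add: "(\<lambda>a \<in> carrier A. \<delta> a \<oplus>\<^bsub>A\<^esub> \<epsilon> a) \<in> derivations A \<eta>"
    if "\<delta> \<in> derivations A \<eta>" "\<epsilon> \<in> derivations A \<eta>" for \<delta> \<epsilon>
  proof (rule derivationsI)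
    note D1 = D[OF that(1)] and D2 = D[OF that(2)]
    fix a b c assume a: "a \<in> carrier A" and b: "b \<in> carrier A"
    show "(\<lambda>a \<in> carrier A. \<delta> a \<oplus>\<^bsub>A\<^esub> \<epsilon> a) (a \<oplus>\<^bsub>A\<^esub> b)
      = (\<lambda>a \<in> carrier A. \<delta> a \<oplus>\<^bsub>A\<^esub> \<epsilon> a) a \<oplus>\<^bsub>A\<^esub> (\<lambda>a \<in> carrier A. \<delta> a \<oplus>\<^bsub>A\<^esub> \<epsilon> a) b"
      using a b by (simp add: D1(2,3) D2(2,3) a_ac)
    show "(\<lambda>a \<in> carrier A. \<delta> a \<oplus>\<^bsub>A\<^esub> \<epsilon> a) (\<eta> c \<otimes>\<^bsub>A\<^esub> a)
      = \<eta> c \<otimes>\<^bsub>A\<^esub> (\<lambda>a \<in> carrier A. \<delta> a \<oplus>\<^bsub>A\<^esub> \<epsilon> a) a"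
      using a by (simp add: \<eta> D1(2,4) D2(2,4) r_distr)
    show "(\<lambda>a \<in> carrier A. \<delta> a \<oplus>\<^bsub>A\<^esub> \<epsilon> a) (a \<otimes>\<^bsub>A\<^esub> b)
      = (\<lambda>a \<in> carrier A. \<delta> a \<oplus>\<^bsub>A\<^esub> \<epsilon> a) a \<otimes>\<^bsub>A\<^esub> b
        \<oplus>\<^bsub>A\<^esub> a \<otimes>\<^bsub>A\<^esub> (\<lambda>a \<in> carrier A. \<delta> a \<oplus>\<^bsub>A\<^esub> \<epsilon> a) b"
      using a b by (simp add: D1(2,5) D2(2,5) l_distr r_distr a_ac)
  qed (auto simp: D(2)[OF that(1)] D(2)[OF that(2)])
  have smult: "(\<lambda>a \<in> carrier A. r \<otimes>\<^bsub>A\<^esub> \<delta> a) \<in> derivations A \<eta>"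
    if "r \<in> carrier A" "\<delta> \<in> derivations A \<eta>" for r \<delta>
  proof (rule derivationsI)
    note D1 = D[OF that(2)]
    fix a b c assume a: "a \<in> carrier A" and b: "b \<in> carrier A"
    show "(\<lambda>a \<in> carrier A. r \<otimes>\<^bsub>A\<^esub> \<delta> a) (a \<oplus>\<^bsub>A\<^esub> b)
      = (\<lambda>a \<in> carrier A. r \<otimes>\<^bsub>A\<^esub> \<delta> a) a \<oplus>\<^bsub>A\<^esub> (\<lambda>a \<in> carrier A. r \<otimes>\<^bsub>A\<^esub> \<delta> a) b"
      using a b that(1) by (simp add: D1(2,3) r_distr)
    show "(\<lambda>a \<in> carrier A. r \<otimes>\<^bsub>A\<^esub> \<delta> a) (\<eta> c \<otimes>\<^bsub>A\<^esub> a)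
      = \<eta> c \<otimes>\<^bsub>A\<^esub> (\<lambda>a \<in> carrier A. r \<otimes>\<^bsub>A\<^esub> \<delta> a) a"
      using a that(1) by (simp add: \<eta> D1(2,4) m_lcomm)
    show "(\<lambda>a \<in> carrier A. r \<otimes>\<^bsub>A\<^esub> \<delta> a) (a \<otimes>\<^bsub>A\<^esub> b)
      = (\<lambda>a \<in> carrier A. r \<otimes>\<^bsub>A\<^esub> \<delta> a) a \<otimes>\<^bsub>A\<^esub> b
        \<oplus>\<^bsub>A\<^esub> a \<otimes>\<^bsub>A\<^esub> (\<lambda>a \<in> carrier A. r \<otimes>\<^bsub>A\<^esub> \<delta> a) b"
      using a b that(1) by (simp add: D1(2,5) r_distr m_assoc m_lcomm)
  qed (auto simp: that(1) D(2)[OF that(2)])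
  have neg: "\<exists>\<epsilon> \<in> derivations A \<eta>. (\<lambda>a \<in> carrier A. \<delta> a \<oplus>\<^bsub>A\<^esub> \<epsilon> a) = (\<lambda>a \<in> carrier A. \<zero>\<^bsub>A\<^esub>)"
    if "\<delta> \<in> derivations A \<eta>" for \<delta>
    using smult[of "\<ominus>\<^bsub>A\<^esub> \<one>\<^bsub>A\<^esub>", OF _ that]
    by (rule bexI[rotated]) (auto simp: D(2)[OF that] l_minus r_neg cong: restrict_cong)
  show ?thesis
  proof (rule module_criteria[OF \<open>cring A\<close>])
    show "\<forall>\<delta> \<in> carrier (Der A \<eta>). \<exists>\<epsilon> \<in> carrier (Der A \<eta>). \<delta> \<oplus>\<^bsub>Der A \<eta>\<^esub> \<epsilon> = \<zero>\<^bsub>Der A \<eta>\<^esub>"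
      using neg by simp
  next
    show "\<forall>\<delta> \<in> carrier (Der A \<eta>). \<delta> \<oplus>\<^bsub>Der A \<eta>\<^esub> \<zero>\<^bsub>Der A \<eta>\<^esub> = \<delta>"
    proof (intro ballI, rule derivation_ext)
      fix \<delta> assume \<delta>: "\<delta> \<in> carrier (Der A \<eta>)"
      then show "\<delta> \<oplus>\<^bsub>Der A \<eta>\<^esub> \<zero>\<^bsub>Der A \<eta>\<^esub> \<in> derivations A \<eta>"
        using add[OF _ zero] by simp
    qed (auto simp: D(2))
  next
    show "\<forall>\<delta> \<in> carrier (Der A \<eta>). \<one>\<^bsub>A\<^esub> \<odot>\<^bsub>Der A \<eta>\<^esub> \<delta> = \<delta>"
    proof (intro ballI, rule derivation_ext)
      fix \<delta> assume \<delta>: "\<delta> \<in> carrier (Der A \<eta>)"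
      then show "\<one>\<^bsub>A\<^esub> \<odot>\<^bsub>Der A \<eta>\<^esub> \<delta> \<in> derivations A \<eta>"
        using smult[OF one_closed] by simp
    qed (auto simp: D(2))
  qed (auto simp: zero add smult D(2) a_ac m_ac l_distr r_distr cong: restrict_cong)
qed

locale affine_algebra =
  fixes W :: "'v set" and I :: "('v, 'k::comm_ring_1) mpol set"
  assumes finite_W: "finite W" and ideal_I: "ideal I (mpoly_ring W)"
begin

abbreviation Q :: "('v, 'k) mpol ring" where "Q \<equiv> mpoly_ring W"
abbreviation R :: "('v, 'k) mpol set ring" where "R \<equiv> Q Quot I"
abbreviation cls :: "('v, 'k) mpol \<Rightarrow> ('v, 'k) mpol set" where "cls f \<equiv> I +>\<^bsub>Q\<^esub> f"
abbreviation scal :: "'k \<Rightarrow> ('v, 'k) mpol set" where "scal c \<equiv> cls (Const c)"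

lemma I_subset: "f \<in> I \<Longrightarrow> f \<in> carrier Q"
  using ideal.Icarr[OF ideal_I] .

lemma I_zero: "0 \<in> I"
  using additive_subgroup.zero_closed[OF ideal.axioms(1)[OF ideal_I]] by simp

lemma I_add: "\<lbrakk>f \<in> I; g \<in> I\<rbrakk> \<Longrightarrow> f + g \<in> I"
  using additive_subgroup.a_closed[OF ideal.axioms(1)[OF ideal_I]] by simp

lemma I_mult: "\<lbrakk>f \<in> I; g \<in> carrier Q\<rbrakk> \<Longrightarrow> g * f \<in> I"
  using ideal.I_l_closed[OF ideal_I] by simp

lemma I_sum: "(\<And>i. i \<in> F \<Longrightarrow> f i \<in> I) \<Longrightarrow> sum f F \<in> I"
  by (induction F rule: infinite_finite_induct) (auto simp: I_zero I_add)

lemma cring_R: "cring R"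
  by (rule ideal.quotient_is_cring[OF ideal_I cring_mpoly_ring])

lemma cls_closed [simp]: "f \<in> carrier Q \<Longrightarrow> cls f \<in> carrier R"
  using ring_hom_closed[OF ideal.rcos_ring_hom[OF ideal_I]] .

lemma cls_add: "\<lbrakk>f \<in> carrier Q; g \<in> carrier Q\<rbrakk> \<Longrightarrow> cls f \<oplus>\<^bsub>R\<^esub> cls g = cls (f + g)"
  using ring_hom_add[OF ideal.rcos_ring_hom[OF ideal_I]] by force

lemma cls_mult: "\<lbrakk>f \<in> carrier Q; g \<in> carrier Q\<rbrakk> \<Longrightarrow> cls f \<otimes>\<^bsub>R\<^esub> cls g = cls (f * g)"
  using ring_hom_mult[OF ideal.rcos_ring_hom[OF ideal_I]] by force

lemma cls_eq_iff: "\<lbrakk>f \<in> carrier Q; g \<in> carrier Q\<rbrakk> \<Longrightarrow> cls f = cls g \<longleftrightarrow> f - g \<in> I"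
  using ring.quotient_eq_iff_same_a_r_cos[OF cring.axioms(1)[OF cring_mpoly_ring] ideal_I]
  by (metis a_minus_mpoly_ring)

lemma cls_zero: "\<zero>\<^bsub>R\<^esub> = cls 0"
proof -
  interpret R: cring R by (rule cring_R)
  have "cls 0 \<oplus>\<^bsub>R\<^esub> cls 0 = cls 0" by (simp add: cls_add)
  then show ?thesis using R.add.r_cancel_one'[of "cls 0" "cls 0"] by simp
qed

lemma carrier_RE:
  assumes "C \<in> carrier R"
  obtains f where "f \<in> carrier Q" "C = cls f"
  using assms unfolding FactRing_simps by (auto simp: a_r_coset_def)

lemma mem_clsD:
  assumes "f \<in> cls g" "g \<in> carrier Q"
  shows "f \<in> carrier Q" "f - g \<in> I"
  using assms I_subset by (auto simp: a_r_coset_defs)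

lemma mem_cls_self: "g \<in> carrier Q \<Longrightarrow> g \<in> cls g"
  using I_zero by (force simp: a_r_coset_defs)

text \<open>
  The fields tangent to the subscheme cut out by \<open>I\<close>; in the literature they form the
  module of logarithmic vector fields along it.
\<close>

definition logarithmic :: "('v \<Rightarrow> ('v, 'k) mpol) \<Rightarrow> bool"
  where "logarithmic A \<longleftrightarrow> A \<in> W \<rightarrow> carrier Q \<and> vector_field W A ` I \<subseteq> I"

abbreviation induced :: "('v \<Rightarrow> ('v, 'k) mpol) \<Rightarrow> ('v, 'k) mpol set \<Rightarrow> ('v, 'k) mpol set"
  where "induced A \<equiv> induced_map Q I (vector_field W A)"

lemma logarithmicD:
  assumes "logarithmic A"
  shows "A \<in> W \<rightarrow> carrier Q" "v \<in> W \<Longrightarrow> A v \<in> carrier Q" "f \<in> I \<Longrightarrow> vector_field W A f \<in> I"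
  using assms by (auto simp: logarithmic_def)

lemma induced_cls:
  assumes A: "logarithmic A" and g: "g \<in> carrier Q"
  shows "induced A (cls g) = cls (vector_field W A g)"
proof -
  have "cls (vector_field W A f) = cls (vector_field W A g)" if "f \<in> cls g" for f
  proof -
    have f: "f \<in> carrier Q" "f - g \<in> I" using mem_clsD[OF that g] by auto
    have "vector_field W A f - vector_field W A g = vector_field W A (f - g)"
      using vector_field_add[of W A "f - g" g] by simp
    also have "\<dots> \<in> I" using A f by (auto simp: logarithmic_def)
    finally show ?thesis using A f g by (subst cls_eq_iff) (auto simp: logarithmic_def)
  qed
  then have "(\<Union>f \<in> cls g. cls (vector_field W A f)) = (\<Union>f \<in> cls g. cls (vector_field W A g))"
    by (rule SUP_cong[OF refl])
  moreover have "cls g \<noteq> {}" using mem_cls_self[OF g] by blast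
  ultimately have "(\<Union>f \<in> cls g. cls (vector_field W A f)) = cls (vector_field W A g)"
    by (simp only: UN_constant if_False)
  then show ?thesis by (simp only: induced_map_def restrict_apply' cls_closed g)
qed

lemma induced_in_Der:
  assumes A: "logarithmic A"
  shows "induced A \<in> derivations R scal"
proof (rule derivationsI)
  have AQ: "A \<in> W \<rightarrow> carrier Q" using A by (simp add: logarithmic_def)
  show "induced A \<in> carrier R \<rightarrow>\<^sub>E carrier R"
  proof (rule PiE_I)
    show "induced A C \<in> carrier R" if "C \<in> carrier R" for C
      using that by (rule carrier_RE) (simp add: induced_cls[OF A] AQ)
  qed (simp add: induced_map_def)
  show "induced A (a \<oplus>\<^bsub>R\<^esub> b) = induced A a \<oplus>\<^bsub>R\<^esub> induced A b"
    if ab: "a \<in> carrier R" "b \<in> carrier R" for a b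
    using ab by (elim carrier_RE) (simp add: cls_add induced_cls[OF A] AQ vector_field_add)
  show "induced A (scal c \<otimes>\<^bsub>R\<^esub> a) = scal c \<otimes>\<^bsub>R\<^esub> induced A a" if "a \<in> carrier R" for c a
    using that by (elim carrier_RE) (simp add: cls_mult induced_cls[OF A] AQ vector_field_mult)
  show "induced A (a \<otimes>\<^bsub>R\<^esub> b) = induced A a \<otimes>\<^bsub>R\<^esub> b \<oplus>\<^bsub>R\<^esub> a \<otimes>\<^bsub>R\<^esub> induced A b"
    if ab: "a \<in> carrier R" "b \<in> carrier R" for a b
    using ab by (elim carrier_RE) (simp add: cls_mult cls_add induced_cls[OF A] AQ vector_field_mult)
qed

lemma derivation_scal:
  assumes "\<delta> \<in> derivations R scal"
  shows "\<delta> (scal c) = cls 0"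
proof -
  interpret R: cring R by (rule cring_R)
  note D = derivationsD[OF assms]
  have one: "\<delta> \<one>\<^bsub>R\<^esub> \<in> carrier R" by (rule D(2)) simp
  have "\<delta> \<one>\<^bsub>R\<^esub> = \<delta> \<one>\<^bsub>R\<^esub> \<oplus>\<^bsub>R\<^esub> \<delta> \<one>\<^bsub>R\<^esub>"
    using D(5)[of "\<one>\<^bsub>R\<^esub>" "\<one>\<^bsub>R\<^esub>"] one
    by (simp only: R.one_closed R.l_one R.r_one simp_thms)
  then have zero: "\<delta> \<one>\<^bsub>R\<^esub> = \<zero>\<^bsub>R\<^esub>"
    by (rule R.add.r_cancel_one'[OF one one, THEN iffD1])
  have "\<delta> (scal c) = \<delta> (scal c \<otimes>\<^bsub>R\<^esub> \<one>\<^bsub>R\<^esub>)" by simp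
  also have "\<dots> = scal c \<otimes>\<^bsub>R\<^esub> \<delta> \<one>\<^bsub>R\<^esub>" by (rule D(4)) simp
  also have "\<dots> = \<zero>\<^bsub>R\<^esub>" by (simp add: zero)
  finally show ?thesis by (simp only: cls_zero)
qed

text \<open>
  Choosing representatives of the values of \<open>\<delta>\<close> on the variables defines a
  vector field. It agrees with \<open>\<delta>\<close> on all classes since both obey the Leibniz
  rule and kill the constants, and it preserves \<open>I\<close> since \<open>\<delta>\<close> maps
  the zero class to itself.
\<close>

theorem derivation_lifts:
  assumes \<delta>: "\<delta> \<in> derivations R scal"
  obtains A where "logarithmic A" "\<delta> = induced A"
proof -
  note D = derivationsD[OF \<delta>]
  have "\<exists>A. \<forall>v \<in> W. A v \<in> carrier Q \<and> \<delta> (cls (Var v)) = cls (A v)"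
  proof (rule bchoice, rule ballI)
    fix v assume "v \<in> W"
    then have "\<delta> (cls (Var v)) \<in> carrier R" by (simp add: D(2))
    then show "\<exists>f. f \<in> carrier Q \<and> \<delta> (cls (Var v)) = cls f" by (metis carrier_RE)
  qed
  then obtain A where A: "\<And>v. v \<in> W \<Longrightarrow> A v \<in> carrier Q"
    and Av: "\<And>v. v \<in> W \<Longrightarrow> \<delta> (cls (Var v)) = cls (A v)" by blast
  then have AQ: "A \<in> W \<rightarrow> carrier Q" by blast
  have lift: "\<delta> (cls f) = cls (vector_field W A f)" if "f \<in> carrier Q" for f
    using that
  proof (induction f rule: mpoly_ring_induct)
    case (Const c)
    show ?case by (simp add: derivation_scal[OF \<delta>])
  next
    case (Var f v)
    have "\<delta> (cls (Var v * f)) = \<delta> (cls (Var v) \<otimes>\<^bsub>R\<^esub> cls f)"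
      using Var by (simp add: cls_mult)
    also have "\<dots> = cls (A v) \<otimes>\<^bsub>R\<^esub> cls f \<oplus>\<^bsub>R\<^esub> cls (Var v) \<otimes>\<^bsub>R\<^esub> cls (vector_field W A f)"
      using Var by (simp only: D(5) Av cls_closed mpoly_Var_closed)
    also have "\<dots> = cls (A v * f + Var v * vector_field W A f)"
      using Var by (simp add: AQ A cls_mult cls_add)
    finally show ?case using Var by (simp add: vector_field_mult vector_field_Var finite_W)
  next
    case (add f g)
    have "\<delta> (cls (f + g)) = \<delta> (cls f \<oplus>\<^bsub>R\<^esub> cls g)"
      using add by (simp add: cls_add)
    also have "\<dots> = cls (vector_field W A f) \<oplus>\<^bsub>R\<^esub> cls (vector_field W A g)"
      using add by (simp only: D(3) cls_closed)
    also have "\<dots> = cls (vector_field W A f + vector_field W A g)"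
      using add by (simp add: AQ cls_add)
    finally show ?case by (simp add: vector_field_add)
  qed
  have "vector_field W A f \<in> I" if f: "f \<in> I" for f
  proof -
    have "cls (vector_field W A f) = \<delta> (cls f)" using lift[OF I_subset[OF f]] by simp
    also have "cls f = cls 0" using f by (simp add: cls_eq_iff I_subset)
    also have "\<delta> (cls 0) = cls 0" using lift[of 0] by simp
    finally show ?thesis using cls_eq_iff[of "vector_field W A f" 0] AQ f by (simp add: I_subset)
  qed
  then have log: "logarithmic A" using AQ by (auto simp: logarithmic_def)
  have "\<delta> = induced A"
    by (rule derivation_ext[OF \<delta> induced_in_Der[OF log]])
      (auto elim!: carrier_RE simp: lift induced_cls[OF log])
  with log show ?thesis by (rule that)
qed

lemma logarithmic_add:
  "\<lbrakk>logarithmic A; logarithmic B\<rbrakk> \<Longrightarrow> logarithmic (\<lambda>v. A v + B v)"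
  unfolding logarithmic_def
  by (auto simp: vector_field_add_coeff intro!: I_add mpoly_add_closed)

lemma logarithmic_smult:
  "\<lbrakk>logarithmic A; g \<in> carrier Q\<rbrakk> \<Longrightarrow> logarithmic (\<lambda>v. g * A v)"
  unfolding logarithmic_def
  by (auto simp: vector_field_smult_coeff intro!: I_mult mpoly_mult_closed)

lemma logarithmic_zero: "logarithmic (\<lambda>_. 0)"
  by (auto simp: logarithmic_def vector_field_def I_zero)

lemma module_Der_R: "module R (Der R scal)"
  by (rule module_Der[OF cring_R]) simp

lemma induced_add:
  assumes "logarithmic A" "logarithmic B"
  shows "induced (\<lambda>v. A v + B v) = induced A \<oplus>\<^bsub>Der R scal\<^esub> induced B"
proof (rule derivation_ext)
  interpret M: module R "Der R scal" by (rule module_Der_R)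
  show "induced A \<oplus>\<^bsub>Der R scal\<^esub> induced B \<in> derivations R scal"
    using M.M.a_closed[of "induced A" "induced B"] assms by (simp only: Der_simps(1) induced_in_Der)
  fix C assume "C \<in> carrier R"
  then obtain f where f: "f \<in> carrier Q" "C = cls f" by (rule carrier_RE)
  then show "induced (\<lambda>v. A v + B v) C = (induced A \<oplus>\<^bsub>Der R scal\<^esub> induced B) C"
    using assms by (simp add: induced_cls logarithmic_add vector_field_add_coeff cls_add logarithmicD(1))
qed (rule induced_in_Der[OF logarithmic_add[OF assms]])

lemma induced_smult:
  assumes "logarithmic A" "g \<in> carrier Q"
  shows "induced (\<lambda>v. g * A v) = cls g \<odot>\<^bsub>Der R scal\<^esub> induced A"
proof (rule derivation_ext)
  interpret M: module R "Der R scal" by (rule module_Der_R)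
  show "cls g \<odot>\<^bsub>Der R scal\<^esub> induced A \<in> derivations R scal"
    using M.smult_closed[of "cls g" "induced A"] assms by (simp only: Der_simps(1) induced_in_Der cls_closed)
  fix C assume "C \<in> carrier R"
  then obtain f where f: "f \<in> carrier Q" "C = cls f" by (rule carrier_RE)
  then show "induced (\<lambda>v. g * A v) C = (cls g \<odot>\<^bsub>Der R scal\<^esub> induced A) C"
    using assms by (simp add: induced_cls logarithmic_smult vector_field_smult_coeff cls_mult logarithmicD(1))
qed (rule induced_in_Der[OF logarithmic_smult[OF assms]])

lemma induced_zero: "induced (\<lambda>_. 0) = \<zero>\<^bsub>Der R scal\<^esub>"
proof (rule derivation_ext)
  interpret M: module R "Der R scal" by (rule module_Der_R)
  show "\<zero>\<^bsub>Der R scal\<^esub> \<in> derivations R scal"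
    using M.M.zero_closed by (simp only: Der_simps(1))
  fix C assume "C \<in> carrier R"
  then obtain f where "f \<in> carrier Q" "C = cls f" by (rule carrier_RE)
  then show "induced (\<lambda>_. 0) C = \<zero>\<^bsub>Der R scal\<^esub> C"
    by (simp add: induced_cls logarithmic_zero vector_field_def cls_zero)
qed (rule induced_in_Der[OF logarithmic_zero])

end

section \<open>Syzygies of the maximal minors\<close>

text \<open>
  The matrix \<open>X\<close> with rows \<open>1..n\<close> receives \<open>y\<close> as row
  \<open>0\<close>. Columns of \<open>X\<close> and entries of \<open>y\<close> are counted from
  \<open>1\<close>, columns of the result from \<open>0\<close>.
\<close>

definition bordered :: "nat \<Rightarrow> (nat \<Rightarrow> nat \<Rightarrow> 'a::comm_ring_1) \<Rightarrow> (nat \<Rightarrow> 'a) \<Rightarrow> 'a mat"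
  where "bordered n X y = mat (n+1) (n+1) (\<lambda>(i, j). if i = 0 then y (j+1) else X i (j+1))"

text \<open>
  The cofactors along row \<open>0\<close> do not depend on the entries of that row, which is
  therefore set to zero.
\<close>

definition signed_minor :: "nat \<Rightarrow> (nat \<Rightarrow> nat \<Rightarrow> 'a::comm_ring_1) \<Rightarrow> nat \<Rightarrow> 'a"
  where "signed_minor n X j = cofactor (bordered n X (\<lambda>_. 0)) 0 (j - 1)"

lemma bordered_carrier [simp]: "bordered n X y \<in> carrier_mat (n+1) (n+1)"
  by (simp add: bordered_def)

lemma sum_shift_Suc: "(\<Sum>j < n + 1. f j) = (\<Sum>j = 1..n + 1. f (j - 1 :: nat))"
  by (rule sum.reindex_bij_witness[of _ "\<lambda>j. j - 1" "\<lambda>j. j + 1"]) auto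

lemma sum_split_0: "(\<Sum>j < n + 1. f j) = f 0 + (\<Sum>j = 1..n. f (j::nat))"
proof -
  have "{..<n+1} = insert 0 {1..n}" by auto
  then show ?thesis by simp
qed

lemma cofactor_bordered: "cofactor (bordered n X y) 0 (j - 1) = signed_minor n X j"
proof -
  have "mat_delete (bordered n X y) 0 (j - 1) = mat_delete (bordered n X (\<lambda>_. 0)) 0 (j - 1)"
    by (rule eq_matI) (auto simp: mat_delete_def bordered_def)
  then show ?thesis by (simp add: cofactor_def signed_minor_def)
qed

lemma det_bordered: "det (bordered n X y) = (\<Sum>j = 1..n+1. y j * signed_minor n X j)"
proof -
  have "det (bordered n X y) = (\<Sum>j < n+1. bordered n X y $$ (0, j) * cofactor (bordered n X y) 0 j)"
    by (rule laplace_expansion_row[OF bordered_carrier]) simp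
  also have "\<dots> = (\<Sum>j = 1..n+1. bordered n X y $$ (0, j - 1) * cofactor (bordered n X y) 0 (j - 1))"
    by (rule sum_shift_Suc)
  also have "\<dots> = (\<Sum>j = 1..n+1. y j * signed_minor n X j)"
    unfolding cofactor_bordered by (intro sum.cong refl) (auto simp: bordered_def)
  finally show ?thesis .
qed

text \<open>A determinant with a repeated row vanishes; it is expanded along that row.\<close>

lemma rows_annihilate_minors:
  assumes "i \<in> {1..n}"
  shows "(\<Sum>j = 1..n+1. X i j * signed_minor n X j) = 0"
proof -
  have "det (bordered n X (X i)) = 0"
    by (rule Determinant.det_identical_rows[of _ "n+1" 0 i])
      (use assms in \<open>auto simp: bordered_def intro!: eq_vecI\<close>)
  then show ?thesis by (simp add: det_bordered)
qed

text \<open>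
  One entry of \<open>adj M M = det M\<close> for the bordered matrix \<open>M\<close>, with the
  contribution of row \<open>0\<close> split off.
\<close>

lemma adj_bordered_mult:
  assumes "j \<in> {1..n+1}" "l \<in> {1..n+1}"
  shows "signed_minor n X j * y l + (\<Sum>i = 1..n. cofactor (bordered n X y) i (j - 1) * X i l)
    = (if j = l then det (bordered n X y) else 0)"
proof -
  let ?M = "bordered n X y"
  have "(adj_mat ?M * ?M) $$ (j - 1, l - 1) = (det ?M \<cdot>\<^sub>m 1\<^sub>m (n+1)) $$ (j - 1, l - 1)"
    by (simp only: adj_mat(3)[OF bordered_carrier])
  also have "(adj_mat ?M * ?M) $$ (j - 1, l - 1)
      = (\<Sum>k < n + 1. cofactor ?M k (j - 1) * ?M $$ (k, l - 1))"
    using assms unfolding times_mat_def scalar_prod_def adj_mat_def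
    by (auto simp: bordered_def lessThan_atLeast0 intro!: sum.cong)
  also have "\<dots> = signed_minor n X j * y l + (\<Sum>i = 1..n. cofactor ?M i (j - 1) * X i l)"
    unfolding sum_split_0 cofactor_bordered using assms
    by (intro arg_cong2[of _ _ _ _ "(+)"] sum.cong) (auto simp: bordered_def)
  also have "(det ?M \<cdot>\<^sub>m 1\<^sub>m (n+1)) $$ (j - 1, l - 1) = (if j = l then det ?M else 0)"
    using assms by auto
  finally show ?thesis .
qed

text \<open>
  One entry of \<open>M adj M = det M\<close> for the bordered matrix \<open>M\<close>, away from
  row and column \<open>0\<close>.
\<close>

lemma bordered_mult_adj:
  assumes "i \<in> {1..n}" "m \<in> {1..n}"
  shows "(\<Sum>l = 1..n+1. X i l * cofactor (bordered n X y) m (l - 1))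
    = (if i = m then det (bordered n X y) else 0)"
proof -
  let ?M = "bordered n X y"
  have "(?M * adj_mat ?M) $$ (i, m) = (det ?M \<cdot>\<^sub>m 1\<^sub>m (n+1)) $$ (i, m)"
    by (simp only: adj_mat(2)[OF bordered_carrier])
  also have "(?M * adj_mat ?M) $$ (i, m) = (\<Sum>k < n + 1. ?M $$ (i, k) * cofactor ?M m k)"
    using assms unfolding times_mat_def scalar_prod_def adj_mat_def
    by (auto simp: bordered_def lessThan_atLeast0 intro!: sum.cong)
  also have "\<dots> = (\<Sum>l = 1..n+1. X i l * cofactor ?M m (l - 1))"
    unfolding sum_shift_Suc using assms by (intro sum.cong) (auto simp: bordered_def)
  also have "(det ?M \<cdot>\<^sub>m 1\<^sub>m (n+1)) $$ (i, m) = (if i = m then det ?M else 0)"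
    using assms by auto
  finally show ?thesis .
qed

text \<open>
  If \<open>X w = 0\<close> and the bordering row is the unit vector \<open>e\<^sub>p\<close>, then
  the bordered matrix \<open>M\<close> maps \<open>w\<close> to \<open>w\<^sub>p\<close> times the
  first unit vector, and it has determinant \<open>\<Delta>\<^sub>p\<close>. Apply \<open>adj
  M\<close>.
\<close>

lemma minors_proportional_to_kernel:
  assumes ker: "\<And>i. i \<in> {1..n} \<Longrightarrow> (\<Sum>l = 1..n+1. X i l * w l) = 0"
    and "p \<in> {1..n+1}" "j \<in> {1..n+1}"
  shows "signed_minor n X p * w j = w p * signed_minor n X j"
proof -
  define y where "y = (\<lambda>l. if l = p then 1 else 0 :: 'a)"
  let ?C = "\<lambda>i. cofactor (bordered n X y) i (j - 1)"
  have det: "det (bordered n X y) = signed_minor n X p"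
    using assms by (simp add: det_bordered y_def if_distrib[of "\<lambda>x. x * _"] cong: if_cong)
  have "signed_minor n X p * w j
      = (\<Sum>l = 1..n+1. (if j = l then det (bordered n X y) else 0) * w l)"
    using assms by (simp add: det if_distrib[of "\<lambda>x. x * _"] cong: if_cong)
  also have "\<dots> = (\<Sum>l = 1..n+1. (signed_minor n X j * y l + (\<Sum>i = 1..n. ?C i * X i l)) * w l)"
    by (intro sum.cong refl) (use assms in \<open>simp only: adj_bordered_mult\<close>)
  also have "\<dots> = signed_minor n X j * (\<Sum>l = 1..n+1. y l * w l)
      + (\<Sum>i = 1..n. ?C i * (\<Sum>l = 1..n+1. X i l * w l))"
    unfolding sum_distrib_left sum_distrib_right distrib_right sum.distrib
    by (subst sum.swap) (simp only: mult.assoc)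
  also have "(\<Sum>i = 1..n. ?C i * (\<Sum>l = 1..n+1. X i l * w l)) = 0"
    by (intro sum.neutral ballI) (simp only: ker mult_zero_right)
  also have "(\<Sum>l = 1..n+1. y l * w l) = w p"
    using assms by (simp add: y_def if_distrib[of "\<lambda>x. x * _"] cong: if_cong)
  finally show ?thesis by (simp add: mult.commute)
qed

text \<open>
  The row vector \<open>(0, c)\<close> annihilates the matrix bordered by \<open>e\<^sub>p\<close>,
  so it is killed by the determinant \<open>\<Delta>\<^sub>p\<close>.
\<close>

lemma rows_independent:
  assumes zero: "\<And>l. l \<in> {1..n+1} \<Longrightarrow> (\<Sum>i = 1..n. c i * X i l) = 0"
    and "p \<in> {1..n+1}" "m \<in> {1..n}"
  shows "signed_minor n X p * c m = 0"
proof -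
  define y where "y = (\<lambda>l. if l = p then 1 else 0 :: 'a)"
  let ?C = "\<lambda>l. cofactor (bordered n X y) m (l - 1)"
  have det: "det (bordered n X y) = signed_minor n X p"
    using assms by (simp add: det_bordered y_def if_distrib[of "\<lambda>x. x * _"] cong: if_cong)
  have "signed_minor n X p * c m
      = (\<Sum>i = 1..n. c i * (if i = m then det (bordered n X y) else 0))"
    using assms by (simp add: det if_distrib[of "\<lambda>x. _ * x"] mult.commute cong: if_cong)
  also have "\<dots> = (\<Sum>i = 1..n. c i * (\<Sum>l = 1..n+1. X i l * ?C l))"
    by (intro sum.cong refl) (use assms in \<open>simp only: bordered_mult_adj\<close>)
  also have "\<dots> = (\<Sum>l = 1..n+1. (\<Sum>i = 1..n. c i * X i l) * ?C l)"
    unfolding sum_distrib_left sum_distrib_right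
    by (subst sum.swap) (simp only: mult.assoc)
  also have "\<dots> = 0" by (intro sum.neutral ballI) (simp only: zero mult_zero_left)
  finally show ?thesis .
qed

text \<open>
  Some two of the minors form a weakly regular sequence. Over a Noetherian ring this makes the ideal
  of maximal minors have grade at least two, which is the hypothesis of the Hilbert--Burch theorem.
\<close>

definition coprime_minors :: "nat \<Rightarrow> (nat \<Rightarrow> nat \<Rightarrow> 'a::comm_ring_1) \<Rightarrow> bool"
  where "coprime_minors n X \<longleftrightarrow> (\<exists>p \<in> {1..n+1}. \<exists>q \<in> {1..n+1}.
    (\<forall>b. signed_minor n X p * b = 0 \<longrightarrow> b = 0) \<and>
    (\<forall>b. signed_minor n X p dvd signed_minor n X q * b \<longrightarrow> signed_minor n X p dvd b))"

text \<open>
  From \<open>\<Delta>\<^sub>p w\<^sub>q = w\<^sub>p \<Delta>\<^sub>q\<close> and coprimality,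
  \<open>\<Delta>\<^sub>p\<close> divides \<open>w\<^sub>p\<close>; the quotient is the multiplier
  for all coordinates.
\<close>

lemma kernel_multiple_of_minors:
  assumes "coprime_minors n X"
    and ker: "\<And>i. i \<in> {1..n} \<Longrightarrow> (\<Sum>l = 1..n+1. X i l * w l) = 0"
  shows "\<exists>c. \<forall>j \<in> {1..n+1}. w j = c * signed_minor n X j"
proof -
  obtain p q where pq: "p \<in> {1..n+1}" "q \<in> {1..n+1}"
    and nz: "\<And>b. signed_minor n X p * b = 0 \<Longrightarrow> b = 0"
    and cop: "\<And>b. signed_minor n X p dvd signed_minor n X q * b \<Longrightarrow> signed_minor n X p dvd b"
    using assms(1) unfolding coprime_minors_def by blast
  have prp: "signed_minor n X p * w j = w p * signed_minor n X j" if "j \<in> {1..n+1}" for j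
    by (rule minors_proportional_to_kernel[OF ker pq(1) that])
  have "signed_minor n X p dvd signed_minor n X q * w p"
    using prp[OF pq(2)] by (simp add: dvd_def mult.commute) metis
  then have "signed_minor n X p dvd w p" by (rule cop)
  then obtain c where c: "w p = signed_minor n X p * c" by (rule dvdE)
  have "w j = c * signed_minor n X j" if "j \<in> {1..n+1}" for j
  proof -
    have "signed_minor n X p * (w j - c * signed_minor n X j) = 0"
      using prp[OF that] by (simp add: c algebra_simps)
    from nz[OF this] show ?thesis by simp
  qed
  then show ?thesis by blast
qed

text \<open>
  A syzygy \<open>a\<close> makes the matrix bordered by \<open>a\<close> singular, and its adjugate
  then writes every \<open>\<Delta>\<^sub>j a\<close> as a combination \<open>b\<^sub>j X\<close> of
  the rows. As the rows are independent, \<open>\<Delta>\<^sub>q b\<^sub>p = \<Delta>\<^sub>p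
  b\<^sub>q\<close>, so coprimality allows division of \<open>b\<^sub>p\<close> by
  \<open>\<Delta>\<^sub>p\<close>.
\<close>

lemma syzygy_in_row_space:
  assumes "coprime_minors n X"
    and syz: "(\<Sum>j = 1..n+1. a j * signed_minor n X j) = 0"
  shows "\<exists>c. \<forall>l \<in> {1..n+1}. a l = (\<Sum>i = 1..n. c i * X i l)"
proof -
  let ?D = "signed_minor n X"
  obtain p q where pq: "p \<in> {1..n+1}" "q \<in> {1..n+1}"
    and nz: "\<And>b. ?D p * b = 0 \<Longrightarrow> b = 0"
    and cop: "\<And>b. ?D p dvd ?D q * b \<Longrightarrow> ?D p dvd b"
    using assms(1) unfolding coprime_minors_def by blast
  define b where "b = (\<lambda>j i. - cofactor (bordered n X a) i (j - 1))"
  have b: "?D j * a l = (\<Sum>i = 1..n. b j i * X i l)" if "j \<in> {1..n+1}" "l \<in> {1..n+1}" for j l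
  proof -
    have "det (bordered n X a) = 0" by (simp only: det_bordered syz)
    with adj_bordered_mult[OF that, of X a] show ?thesis
      by (cases "j = l") (simp_all add: b_def sum_negf eq_neg_iff_add_eq_0)
  qed
  have "?D p dvd b p i" if i: "i \<in> {1..n}" for i
  proof -
    have "?D p * (?D q * b p i - ?D p * b q i) = 0"
    proof (rule rows_independent[OF _ pq(1) i, where c = "\<lambda>i. ?D q * b p i - ?D p * b q i"])
      fix l assume l: "l \<in> {1..n+1}"
      have "(\<Sum>i = 1..n. (?D q * b p i - ?D p * b q i) * X i l)
          = ?D q * (\<Sum>i = 1..n. b p i * X i l) - ?D p * (\<Sum>i = 1..n. b q i * X i l)"
        by (simp add: sum_subtractf sum_distrib_left algebra_simps)
      also have "\<dots> = 0" by (simp only: b[OF pq(1) l, symmetric] b[OF pq(2) l, symmetric]) (simp add: algebra_simps)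
      finally show "(\<Sum>i = 1..n. (?D q * b p i - ?D p * b q i) * X i l) = 0" .
    qed
    from nz[OF this] have "?D q * b p i = ?D p * b q i" by simp
    then have "?D p dvd ?D q * b p i" by simp
    then show ?thesis by (rule cop)
  qed
  then have "\<exists>c. \<forall>i \<in> {1..n}. b p i = ?D p * c i"
    by (intro bchoice ballI) (simp add: dvd_def)
  then obtain c where c: "\<And>i. i \<in> {1..n} \<Longrightarrow> b p i = ?D p * c i" by blast
  have "a l = (\<Sum>i = 1..n. c i * X i l)" if l: "l \<in> {1..n+1}" for l
  proof -
    have "(\<Sum>i = 1..n. b p i * X i l) = ?D p * (\<Sum>i = 1..n. c i * X i l)"
      unfolding sum_distrib_left by (intro sum.cong refl) (simp add: c mult.assoc)
    then have "?D p * (a l - (\<Sum>i = 1..n. c i * X i l)) = 0"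
      using b[OF pq(1) l] by (simp add: right_diff_distrib)
    from nz[OF this] show ?thesis by simp
  qed
  then show ?thesis by blast
qed

section \<open>Coprimality of two generic minors\<close>

definition weight :: "('v \<Rightarrow> nat) \<Rightarrow> ('v \<Rightarrow>\<^sub>0 nat) \<Rightarrow> nat"
  where "weight w m = (\<Sum>v \<in> Poly_Mapping.keys m. w v * Poly_Mapping.lookup m v)"

lemma weight_superset:
  "finite S \<Longrightarrow> Poly_Mapping.keys m \<subseteq> S \<Longrightarrow> weight w m = (\<Sum>v \<in> S. w v * Poly_Mapping.lookup m v)"
  unfolding weight_def by (rule sum.mono_neutral_left) (auto simp: in_keys_iff)

lemma weight_add: "weight w (a + b) = weight w a + weight w b"
proof -
  let ?S = "Poly_Mapping.keys a \<union> Poly_Mapping.keys b"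
  have "weight w (a + b) = (\<Sum>v \<in> ?S. w v * Poly_Mapping.lookup (a + b) v)"
    by (rule weight_superset) (auto simp: keys_add_nat)
  also have "\<dots> = (\<Sum>v \<in> ?S. w v * Poly_Mapping.lookup a v) + (\<Sum>v \<in> ?S. w v * Poly_Mapping.lookup b v)"
    by (simp add: lookup_add distrib_left sum.distrib)
  also have "\<dots> = weight w a + weight w b"
    by (simp flip: weight_superset)
  finally show ?thesis .
qed

lemma weight_zero [simp]: "weight w 0 = 0"
  and weight_single [simp]: "weight w (Poly_Mapping.single v k) = w v * k"
  by (simp_all add: weight_def)

lemma weight_sum: "weight w (sum f F) = (\<Sum>i \<in> F. weight w (f i))"
  by (induction F rule: infinite_finite_induct) (auto simp: weight_add)

definition leads :: "('v \<Rightarrow> nat) \<Rightarrow> ('v, 'k::field) mpol \<Rightarrow> ('v \<Rightarrow>\<^sub>0 nat) \<Rightarrow> bool"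
  where "leads w f m \<longleftrightarrow> m \<in> Poly_Mapping.keys f \<and>
    (\<forall>m' \<in> Poly_Mapping.keys f. m' \<noteq> m \<longrightarrow> weight w m' < weight w m)"

lemma lookup_single_mult:
  fixes b :: "('v, 'k::field) mpol"
  shows "Poly_Mapping.lookup (Poly_Mapping.single a c * b) (a + m) = c * Poly_Mapping.lookup b m"
proof (induction b rule: poly_mapping_additive_induct)
  case (single m' c')
  show ?case by (auto simp: mult_single lookup_single when_def)
qed (auto simp: lookup_add algebra_simps)

lemma keys_single_mult:
  fixes b :: "('v, 'k::field) mpol"
  assumes "Poly_Mapping.lookup (Poly_Mapping.single a c * b) k \<noteq> 0"
  obtains m where "k = a + m"
  using assms keys_mult[of "Poly_Mapping.single a c" b] by (force simp: in_keys_iff[symmetric] split: if_splits)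

text \<open>
  In weights at least as large as those of all products of the leading monomial with a monomial of
  \<open>b\<close>, the other terms of \<open>f\<close> do not contribute to \<open>f * b\<close>.
\<close>

lemma lookup_mult_top:
  fixes f :: "('v, 'k::field) mpol"
  assumes "leads w f mf" and "\<And>m. m \<in> Poly_Mapping.keys b \<Longrightarrow> weight w mf + weight w m \<le> weight w k"
  shows "Poly_Mapping.lookup (f * b) k
    = Poly_Mapping.lookup (Poly_Mapping.single mf (Poly_Mapping.lookup f mf) * b) k"
proof -
  define f' where "f' = f - Poly_Mapping.single mf (Poly_Mapping.lookup f mf)"
  have f': "weight w m < weight w mf" if "m \<in> Poly_Mapping.keys f'" for m
  proof -
    have "Poly_Mapping.lookup f m \<noteq> 0" "m \<noteq> mf"
      using that by (auto simp: f'_def in_keys_iff lookup_minus lookup_single when_def split: if_splits)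
    then show ?thesis using assms(1) by (auto simp: leads_def in_keys_iff)
  qed
  have "k \<notin> Poly_Mapping.keys (f' * b)"
  proof
    assume "k \<in> Poly_Mapping.keys (f' * b)"
    then obtain a m where "k = a + m" "a \<in> Poly_Mapping.keys f'" "m \<in> Poly_Mapping.keys b"
      using keys_mult[of f' b] by blast
    then show False using f'[of a] assms(2)[of m] by (simp add: weight_add)
  qed
  then have "Poly_Mapping.lookup (f' * b) k = 0" by (simp add: in_keys_iff)
  then show ?thesis by (simp add: f'_def left_diff_distrib lookup_minus)
qed

text \<open>
  A monomial of \<open>b\<close> of maximal weight, multiplied by the leading monomial of
  \<open>f\<close>, cannot cancel. Such a statement replaces the multiplicativity of leading
  monomials: a weight only orders monomials partially, so \<open>b\<close> need not have a leading
  one.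
\<close>

lemma leads_mult_exceeds:
  fixes f :: "('v, 'k::field) mpol"
  assumes "leads w f mf" and "m \<in> Poly_Mapping.keys b"
  obtains m0 where "weight w m \<le> weight w m0" "mf + m0 \<in> Poly_Mapping.keys (f * b)"
proof -
  define M where "M = Max (weight w ` Poly_Mapping.keys b)"
  have "M \<in> weight w ` Poly_Mapping.keys b"
    unfolding M_def by (rule Max_in) (use assms in auto)
  then obtain m0 where m0: "m0 \<in> Poly_Mapping.keys b" "weight w m0 = M" by blast
  have le: "weight w m' \<le> weight w m0" if "m' \<in> Poly_Mapping.keys b" for m'
    unfolding m0(2) M_def using that by (intro Max_ge) auto
  have "Poly_Mapping.lookup (f * b) (mf + m0)
      = Poly_Mapping.lookup (Poly_Mapping.single mf (Poly_Mapping.lookup f mf) * b) (mf + m0)"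
    by (rule lookup_mult_top[OF assms(1)]) (use le in \<open>simp add: weight_add\<close>)
  also have "\<dots> \<noteq> 0"
    using m0(1) assms(1) by (simp add: lookup_single_mult leads_def in_keys_iff)
  finally show ?thesis using le[OF assms(2)] by (intro that[of m0]) (auto simp: in_keys_iff)
qed

lemma leads_nonzerodivisor:
  fixes f :: "('v, 'k::field) mpol"
  assumes "leads w f mf" "f * b = 0"
  shows "b = 0"
proof (rule ccontr)
  assume "b \<noteq> 0"
  then obtain m where "m \<in> Poly_Mapping.keys b"
    by (metis ex_in_conv keys_eq_empty)
  then show False using leads_mult_exceeds[OF assms(1)] assms(2) by (metis empty_iff keys_zero)
qed

text \<open>
  Compare the parts of highest weight in \<open>f * b = g * q\<close>: the leading monomial of
  \<open>g\<close> divides the product of that of \<open>f\<close> with every top monomial of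
  \<open>b\<close>; having no variable in common with the former, it divides the latter. Subtracting
  a multiple of \<open>g\<close> from \<open>b\<close> removes its top part, and induction on the
  weight finishes the argument.
\<close>

lemma coprime_leading_monomials:
  fixes f g :: "('v, 'k::field) mpol"
  assumes f: "leads w f mf" and g: "leads w g mg"
    and disj: "Poly_Mapping.keys mf \<inter> Poly_Mapping.keys mg = {}"
    and "g dvd f * b"
  shows "g dvd b"
proof -
  define N where "N = Suc (Max (weight w ` Poly_Mapping.keys b))"
  have "weight w m < N" if "m \<in> Poly_Mapping.keys b" for m
    unfolding N_def using that by (simp add: le_imp_less_Suc)
  then show ?thesis using \<open>g dvd f * b\<close>
  proof (induction N arbitrary: b)
    case 0
    then have "b = 0" by (metis ex_in_conv keys_eq_empty less_nat_zero_code)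
    then show ?case by simp
  next
    case (Suc N)
    obtain q where q: "f * b = g * q" using Suc.prems(2) by (auto elim: dvdE)
    let ?d = "Poly_Mapping.lookup g mg"
    have d: "?d \<noteq> 0" using g by (simp add: leads_def in_keys_iff)
    have bN: "weight w m \<le> N" if "m \<in> Poly_Mapping.keys b" for m
      using Suc.prems(1)[OF that] by simp
    have qN: "weight w mg + weight w m \<le> weight w mf + N" if m: "m \<in> Poly_Mapping.keys q" for m
    proof -
      obtain m0 where m0: "weight w m \<le> weight w m0" "mg + m0 \<in> Poly_Mapping.keys (f * b)"
        using leads_mult_exceeds[OF g m] unfolding q by blast
      then obtain a a' where a: "mg + m0 = a + a'" "a \<in> Poly_Mapping.keys f" "a' \<in> Poly_Mapping.keys b"
        using keys_mult[of f b] by blast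
      have "weight w a \<le> weight w mf" using a(2) f by (cases "a = mf") (auto simp: leads_def)
      then show ?thesis using m0(1) bN[OF a(3)] arg_cong[OF a(1), of "weight w"]
        by (simp add: weight_add)
    qed
    have dvd: "mg + (m - mg) = m" if m: "m \<in> Poly_Mapping.keys b" "weight w m = N" for m
    proof -
      have "Poly_Mapping.lookup (f * b) (mf + m)
          = Poly_Mapping.lookup (Poly_Mapping.single mf (Poly_Mapping.lookup f mf) * b) (mf + m)"
        by (rule lookup_mult_top[OF f]) (use bN m in \<open>simp add: weight_add\<close>)
      also have "\<dots> \<noteq> 0"
        using m(1) f by (simp add: lookup_single_mult leads_def in_keys_iff)
      also have "Poly_Mapping.lookup (f * b) (mf + m)
          = Poly_Mapping.lookup (Poly_Mapping.single mg ?d * q) (mf + m)"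
        unfolding q by (rule lookup_mult_top[OF g]) (use qN m in \<open>simp add: weight_add\<close>)
      finally obtain m' where "mf + m = mg + m'" by (metis keys_single_mult)
      then have *: "Poly_Mapping.lookup mf v + Poly_Mapping.lookup m v
          = Poly_Mapping.lookup mg v + Poly_Mapping.lookup m' v" for v
        by (metis lookup_add)
      have "Poly_Mapping.lookup mg v \<le> Poly_Mapping.lookup m v" for v
      proof (cases "v \<in> Poly_Mapping.keys mg")
        case True
        then have "Poly_Mapping.lookup mf v = 0" using disj by (metis disjoint_iff in_keys_iff)
        then show ?thesis using *[of v] by simp
      qed (simp add: in_keys_iff)
      then show ?thesis by (intro poly_mapping_eqI) (simp add: lookup_add lookup_minus)
    qed
    define T where "T = {m \<in> Poly_Mapping.keys b. weight w m = N}"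
    define t where "t = (\<Sum>m \<in> T. Poly_Mapping.single (m - mg) (Poly_Mapping.lookup b m / ?d))"
    have dT: "mg + (m - mg) = m" if "m \<in> T" for m using dvd that by (auto simp: T_def)
    have keys_t: "Poly_Mapping.keys t \<subseteq> (\<lambda>m. m - mg) ` T"
      unfolding t_def by (rule order_trans[OF keys_sum]) auto
    have wt: "weight w mg + weight w m = N" if "m \<in> Poly_Mapping.keys t" for m
    proof -
      from that keys_t have "m \<in> (\<lambda>m. m - mg) ` T" by (rule subsetD[rotated])
      then obtain m' where "m' \<in> T" "m = m' - mg" by (rule imageE) simp
      then show ?thesis using dT[of m'] by (metis (mono_tags) T_def mem_Collect_eq weight_add)
    qed
    have top: "Poly_Mapping.single mg ?d * t = (\<Sum>m \<in> T. Poly_Mapping.single m (Poly_Mapping.lookup b m))"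
      unfolding t_def sum_distrib_left
      by (intro sum.cong refl) (use d in \<open>simp add: mult_single dT\<close>)
    have fin: "finite T" by (simp add: T_def)
    have "weight w k < N" if k: "k \<in> Poly_Mapping.keys (b - g * t)" for k
    proof (rule ccontr)
      assume "\<not> weight w k < N"
      then consider "weight w k = N" | "weight w k > N" by linarith
      then have "Poly_Mapping.lookup (b - g * t) k = 0"
      proof cases
        case 1
        have "Poly_Mapping.lookup (g * t) k = Poly_Mapping.lookup (Poly_Mapping.single mg ?d * t) k"
          by (rule lookup_mult_top[OF g]) (simp add: wt 1)
        also have "\<dots> = Poly_Mapping.lookup b k"
          unfolding top lookup_sum lookup_single when_def
          using fin 1 by (auto simp: sum.delta T_def in_keys_iff)
        finally show ?thesis by (simp add: lookup_minus)
      next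
        case 2
        have "k \<notin> Poly_Mapping.keys b" using bN[of k] 2 by auto
        moreover have "k \<notin> Poly_Mapping.keys (g * t)"
        proof
          assume "k \<in> Poly_Mapping.keys (g * t)"
          then obtain a m where a: "k = a + m" "a \<in> Poly_Mapping.keys g" "m \<in> Poly_Mapping.keys t"
            using keys_mult[of g t] by blast
          have "weight w a \<le> weight w mg" using a(2) g by (cases "a = mg") (auto simp: leads_def)
          then show False using wt[OF a(3)] 2 by (simp add: a(1) weight_add)
        qed
        ultimately show ?thesis by (simp add: in_keys_iff lookup_minus)
      qed
      then show False using k by (simp add: in_keys_iff)
    qed
    moreover have "g dvd f * (b - g * t)"
      unfolding right_diff_distrib q by (metis dvd_diff dvd_mult dvd_triv_left)
    ultimately have "g dvd b - g * t" by (rule Suc.IH)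
    then show ?case by (metis diff_add_cancel dvd_add dvd_triv_left)
  qed
qed

abbreviation generic_minor :: "nat \<Rightarrow> nat \<Rightarrow> 'k::field xpol"
  where "generic_minor n \<equiv> signed_minor n xv"

text \<open>
  The monomial that the permutation \<open>\<pi>\<close> contributes to the determinant of the
  generic matrix without column \<open>j\<close>. The function \<open>insert_index (j - 1)\<close>
  enumerates the remaining columns.
\<close>

definition term_monomial :: "nat \<Rightarrow> nat \<Rightarrow> (nat \<Rightarrow> nat) \<Rightarrow> (nat \<times> nat) \<Rightarrow>\<^sub>0 nat"
  where "term_monomial n j \<pi> = (\<Sum>i<n. Poly_Mapping.single (i + 1, insert_index (j - 1) (\<pi> i) + 1) 1)"

lemma prod_Var: "(\<Prod>i \<in> F. Var (f i)) = Poly_Mapping.single (\<Sum>i \<in> F. Poly_Mapping.single (f i) 1) 1"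
  by (induction F rule: infinite_finite_induct) (auto simp: Var_def mult_single)

lemma mat_delete_generic:
  "mat_delete (bordered n xv y) 0 (j - 1) = mat n n (\<lambda>(i, k). xv (i + 1) (insert_index (j - 1) k + 1))"
  by (rule eq_matI) (auto simp: mat_delete_def bordered_def insert_index_def)

lemma generic_minor_det:
  "generic_minor n j = (-1) ^ (j - 1) * det (mat n n (\<lambda>(i, k). xv (i + 1) (insert_index (j - 1) k + 1)))"
  unfolding signed_minor_def cofactor_def mat_delete_generic by simp

lemma generic_minor_expand:
  "generic_minor n j = (\<Sum>\<pi> | \<pi> permutes {0..<n}.
    (-1) ^ (j - 1) * signof \<pi> * Poly_Mapping.single (term_monomial n j \<pi>) 1)"
proof -
  have "det (mat n n (\<lambda>(i, k). xv (i + 1) (insert_index (j - 1) k + 1)) :: 'a xpol mat)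
    = (\<Sum>\<pi> | \<pi> permutes {0..<n}. signof \<pi> * (\<Prod>i = 0..<n. xv (i + 1) (insert_index (j - 1) (\<pi> i) + 1)))"
    by (subst det_def'[of _ n])
      (auto intro!: sum.cong arg_cong2[of _ _ _ _ "(*)"] prod.cong simp: permutes_in_image)
  then show ?thesis
    unfolding generic_minor_det prod_Var term_monomial_def
    by (simp add: sum_distrib_left lessThan_atLeast0 mult.assoc)
qed

lemma signs_as_singles:
  "(-1) ^ k * signof \<pi> * Poly_Mapping.single m (1 :: 'k::field)
    = Poly_Mapping.single m ((-1) ^ k * signof \<pi> :: 'k)"
  by (cases "even k") (auto simp: sign_def single_uminus)

lemma keys_generic_minor:
  "Poly_Mapping.keys (generic_minor n j :: 'k::field xpol) \<subseteq> term_monomial n j ` {\<pi>. \<pi> permutes {0..<n}}"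
  unfolding generic_minor_expand signs_as_singles by (rule order_trans[OF keys_sum]) auto

lemma weight_term_monomial:
  "weight w (term_monomial n j \<pi>) = (\<Sum>i<n. w (i + 1, insert_index (j - 1) (\<pi> i) + 1))"
  by (simp add: term_monomial_def weight_sum)

text \<open>
  The difference of the two sums is half of \<open>\<Sum>i. (i - \<pi> i)\<^sup>2\<close>; the
  shifts by \<open>1\<close> and \<open>e\<close> change both sums by the same amount.
\<close>

lemma rearrangement:
  assumes "\<pi> permutes {0..<n}" "\<pi> \<noteq> id"
  shows "(\<Sum>i<n. (i + 1) * (\<pi> i + e)) < (\<Sum>i<n. (i + 1) * (i + e :: nat))"
proof -
  have perm: "(\<Sum>i<n. h (\<pi> i)) = (\<Sum>i<n. h i)" for h :: "nat \<Rightarrow> int"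
    using sum.permute[OF assms(1), of h] by (simp add: comp_def lessThan_atLeast0)
  obtain i0 where i0: "\<pi> i0 \<noteq> i0" using assms(2) by (auto simp: fun_eq_iff)
  then have "i0 < n" using assms(1) by (metis atLeastLessThan_iff le0 permutes_not_in)
  have "0 < (\<Sum>i<n. (int i - int (\<pi> i))\<^sup>2)"
    by (rule sum_pos2[of _ i0]) (use i0 \<open>i0 < n\<close> in auto)
  also have "\<dots> = (\<Sum>i<n. (int i)\<^sup>2) + (\<Sum>i<n. (int (\<pi> i))\<^sup>2) - 2 * (\<Sum>i<n. int i * int (\<pi> i))"
    by (simp add: power2_diff sum.distrib sum_subtractf sum_distrib_left mult.assoc)
  also have "(\<Sum>i<n. (int (\<pi> i))\<^sup>2) = (\<Sum>i<n. (int i)\<^sup>2)"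
    using perm[of "\<lambda>i. (int i)\<^sup>2"] by simp
  finally have *: "(\<Sum>i<n. int i * int (\<pi> i)) < (\<Sum>i<n. int i * int i)"
    by (simp add: power2_eq_square)
  have "int (\<Sum>i<n. (i + 1) * (\<pi> i + e))
      = (\<Sum>i<n. int i * int (\<pi> i)) + (\<Sum>i<n. int (\<pi> i)) + int e * (\<Sum>i<n. int i + 1)"
    by (simp add: algebra_simps sum.distrib sum_distrib_left)
  also have "\<dots> < (\<Sum>i<n. int i * int i) + (\<Sum>i<n. int i) + int e * (\<Sum>i<n. int i + 1)"
    using * perm[of int] by simp
  also have "\<dots> = int (\<Sum>i<n. (i + 1) * (i + e))"
    by (simp add: algebra_simps sum.distrib sum_distrib_left)
  finally show ?thesis by (simp only: of_nat_less_iff)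
qed

abbreviation diagonal_weight :: "nat \<times> nat \<Rightarrow> nat"
  where "diagonal_weight \<equiv> \<lambda>(i, j). i * j"

lemma leads_outer_minor:
  assumes j: "j = 1 \<or> j = n + 1"
  shows "leads diagonal_weight (generic_minor n j :: 'k::field xpol) (term_monomial n j id)"
proof -
  \<comment> \<open>Without its first column the remaining columns are \<open>2..n+1\<close>, without its last one they are \<open>1..n\<close>.\<close>
  define e where "e = (if j = 1 then 2 else 1 :: nat)"
  have less: "weight diagonal_weight (term_monomial n j \<pi>) < weight diagonal_weight (term_monomial n j id)"
    if \<pi>: "\<pi> permutes {0..<n}" "\<pi> \<noteq> id" for \<pi>
  proof -
    have *: "(\<Sum>i<n. (i + 1) * (insert_index (j - 1) (\<sigma> i) + 1)) = (\<Sum>i<n. (i + 1) * (\<sigma> i + e))"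
      if "\<sigma> permutes {0..<n}" for \<sigma>
    proof (intro sum.cong refl)
      fix i assume "i \<in> {..<n}"
      then have "\<sigma> i < n" using that by (metis atLeastLessThan_iff le0 lessThan_iff permutes_in_image)
      then show "(i + 1) * (insert_index (j - 1) (\<sigma> i) + 1) = (i + 1) * (\<sigma> i + e)"
        using j by (auto simp: e_def)
    qed
    show ?thesis
      using rearrangement[OF \<pi>, of e] *[OF \<pi>(1)] *[OF permutes_id]
      by (simp add: weight_term_monomial)
  qed
  have "Poly_Mapping.lookup (generic_minor n j :: 'k xpol) (term_monomial n j id)
      = (\<Sum>\<pi> | \<pi> permutes {0..<n}. if \<pi> = id then (-1) ^ (j - 1) else 0)"
    unfolding generic_minor_expand signs_as_singles lookup_sum
  proof (intro sum.cong refl)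
    fix \<pi> assume "\<pi> \<in> {\<pi>. \<pi> permutes {0..<n}}"
    then show "Poly_Mapping.lookup (Poly_Mapping.single (term_monomial n j \<pi>) ((-1) ^ (j - 1) * signof \<pi> :: 'k))
        (term_monomial n j id) = (if \<pi> = id then (-1) ^ (j - 1) else 0)"
      using less[of \<pi>] by (auto simp: lookup_single when_def)
  qed
  also have "\<dots> = (-1) ^ (j - 1)"
    using permutes_id[of "{0..<n}"] by (simp add: sum.delta finite_permutations)
  finally have "term_monomial n j id \<in> Poly_Mapping.keys (generic_minor n j :: 'k xpol)"
    by (simp add: in_keys_iff)
  then show ?thesis
    using keys_generic_minor[where 'k = 'k] less by (fastforce simp: leads_def)
qed

lemma keys_term_monomial: "Poly_Mapping.keys (term_monomial n j \<pi>) = (\<lambda>i. (i + 1, insert_index (j - 1) (\<pi> i) + 1)) ` {..<n}"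
proof -
  have "Poly_Mapping.keys (\<Sum>i \<in> F. Poly_Mapping.single (f i) (1::nat)) = f ` F" if "finite F" for F :: "nat set" and f :: "nat \<Rightarrow> nat \<times> nat"
    using that by (induction rule: finite_induct) (auto simp: keys_add_nat)
  then show ?thesis by (simp add: term_monomial_def)
qed

text \<open>
  The leading monomials are supported on the diagonals \<open>x\<^bsub>i,i\<^esub>\<close> and
  \<open>x\<^bsub>i,i+1\<^esub>\<close>.
\<close>

lemma coprime_minors_generic: "coprime_minors n (xv :: nat \<Rightarrow> nat \<Rightarrow> 'k::field xpol)"
proof -
  note l1 = leads_outer_minor[of 1 n, where 'k = 'k, OF disjI1[OF refl]]
    and l2 = leads_outer_minor[of "n + 1" n, where 'k = 'k, OF disjI2[OF refl]]
  have "Poly_Mapping.keys (term_monomial n 1 id) \<inter> Poly_Mapping.keys (term_monomial n (n + 1) id) = {}"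
    by (auto simp: keys_term_monomial)
  note cop = coprime_leading_monomials[OF l1 l2 this]
  show ?thesis
    unfolding coprime_minors_def
  proof (intro bexI conjI allI impI)
    show "b = 0" if "generic_minor n (n + 1) * b = 0" for b :: "'k xpol"
      by (rule leads_nonzerodivisor[OF l2 that])
    show "generic_minor n (n + 1) dvd b" if "generic_minor n (n + 1) dvd generic_minor n 1 * b"
      for b :: "'k xpol"
      by (rule cop[OF that])
  qed simp_all
qed

lemma generic_minor_order:
  assumes "m \<in> Poly_Mapping.keys (generic_minor n j :: 'k::field xpol)"
  shows "weight (\<lambda>_. 1) m = n"
  using assms keys_generic_minor[where 'k = 'k] by (force simp: weight_term_monomial)

section \<open>Logarithmic vector fields of the generic matrix\<close>

definition entries :: "nat \<Rightarrow> (nat \<times> nat) set"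
  where "entries n = {1..n} \<times> {1..n+1}"

lemma mem_entries [simp]: "(k, l) \<in> entries n \<longleftrightarrow> k \<in> {1..n} \<and> l \<in> {1..n+1}"
  by (simp add: entries_def)

lemma Q_ring_eq: "Q_ring n = mpoly_ring (entries n)"
  by (simp only: Q_ring_def entries_def)

lemma mpoly_minus_one_power_closed [simp]: "(-1) ^ i \<in> carrier (mpoly_ring W)"
  using mpoly_sign_closed[of i 1 W] by simp

declare sum.cl_ivl_Suc [simp del]

lemma pick_all_but_one:
  assumes "k < n" "j \<le> n"
  shows "pick ({..<n+1} - {j}) k = insert_index j k"
proof -
  let ?S = "{..<n+1} - {j}"
  have "insert_index j k \<in> ?S" using assms by (auto simp: insert_index_def)
  moreover have "{a \<in> ?S. a < insert_index j k} = insert_index j ` {..<k}"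
  proof (intro equalityI subsetI)
    fix a assume a: "a \<in> {a \<in> ?S. a < insert_index j k}"
    show "a \<in> insert_index j ` {..<k}"
    proof (cases "a < j")
      case True
      then show ?thesis using a by (intro image_eqI[of _ _ a]) (auto simp: insert_index_def split: if_splits)
    next
      case False
      then show ?thesis using a by (intro image_eqI[of _ _ "a - 1"]) (auto simp: insert_index_def split: if_splits)
    qed
  qed (use assms in \<open>auto simp: insert_index_def split: if_splits\<close>)
  moreover have "inj (insert_index j)" by (auto simp: inj_def insert_index_def split: if_splits)
  ultimately show ?thesis
    using pick_card_in_set[of "insert_index j k" ?S]
    by (simp add: card_image inj_on_subset)
qed

lemma submatrix_X_mat:
  assumes "j \<le> n"
  shows "submatrix (X_mat n) UNIV ({..<n+1} - {j})
    = mat n n (\<lambda>(i, k). xv (i + 1) (insert_index j k + 1) :: 'k::field xpol)"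
proof -
  have "{l. l < n + 1 \<and> l \<in> {..<n+1} - {j}} = {..<n+1} - {j}" by auto
  then have card: "card {l. l < n + 1 \<and> l \<in> {..<n+1} - {j}} = n" using assms by simp
  show ?thesis
  proof (rule eq_matI)
    fix i k
    assume "i < dim_row (mat n n (\<lambda>(i, k). xv (i + 1) (insert_index j k + 1) :: 'k xpol))"
      and "k < dim_col (mat n n (\<lambda>(i, k). xv (i + 1) (insert_index j k + 1) :: 'k xpol))"
    then have ik: "i < n" "k < n" by auto
    have "insert_index j k < n + 1" using ik by (simp add: insert_index_def)
    then show "submatrix (X_mat n) UNIV ({..<n+1} - {j}) $$ (i, k)
        = mat n n (\<lambda>(i, k). xv (i + 1) (insert_index j k + 1) :: 'k xpol) $$ (i, k)"
      using ik card assms pick_all_but_one[OF ik(2) assms]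
      by (simp add: submatrix_def X_mat_def pick_UNIV)
  qed (use card in \<open>simp_all add: submatrix_def X_mat_def\<close>)
qed

lemma maximal_minors_X_mat:
  "maximal_minors (X_mat n :: 'k::field xpol mat)
    = (\<lambda>j. (-1) ^ (j - 1) * generic_minor n j) ` {1..n+1}"
proof -
  have minor: "det (submatrix (X_mat n) UNIV ({..<n+1} - {j - 1}))
      = (-1) ^ (j - 1) * (generic_minor n j :: 'k xpol)" if "j \<in> {1..n+1}" for j
  proof -
    have "j - 1 \<le> n" using that by auto
    then show ?thesis
      by (simp only: submatrix_X_mat generic_minor_det mult.assoc[symmetric] power_add[symmetric])
        (simp add: power_add)
  qed
  have sets: "{J. J \<subseteq> {..<n+1} \<and> card J = n} = (\<lambda>j. {..<n+1} - {j - 1}) ` {1..n+1}"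
  proof (intro equalityI subsetI)
    fix J assume J: "J \<in> {J. J \<subseteq> {..<n+1} \<and> card J = n}"
    then have "finite J" by (auto intro: finite_subset)
    then have "card ({..<n+1} - J) = 1" using J by (simp add: card_Diff_subset)
    then obtain l where l: "{..<n+1} - J = {l}" by (rule card_1_singletonE)
    then have "J = {..<n+1} - {l}" "l < n + 1" using J by auto
    then show "J \<in> (\<lambda>j. {..<n+1} - {j - 1}) ` {1..n+1}"
      by (intro image_eqI[of _ _ "l + 1"]) auto
  qed auto
  have "maximal_minors (X_mat n :: 'k xpol mat)
      = (\<lambda>J. det (submatrix (X_mat n) UNIV J)) ` {J. J \<subseteq> {..<n+1} \<and> card J = n}"
    by (auto simp: maximal_minors_def X_mat_def)
  then show ?thesis unfolding sets image_image by (simp only: minor cong: image_cong)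
qed

lemma generic_minor_closed [simp]:
  assumes "j \<in> {1..n+1}"
  shows "(generic_minor n j :: 'k::field xpol) \<in> carrier (mpoly_ring (entries n))"
  unfolding carrier_mpoly_ring
proof
  fix m assume "m \<in> Poly_Mapping.keys (generic_minor n j :: 'k xpol)"
  then obtain \<pi> where \<pi>: "\<pi> permutes {0..<n}" "m = term_monomial n j \<pi>"
    using keys_generic_minor[where 'k = 'k] by blast
  have "insert_index (j - 1) (\<pi> i) + 1 \<le> n + 1" if "i < n" for i
    using that permutes_in_image[OF \<pi>(1), of i] by (simp add: insert_index_def)
  then show "Poly_Mapping.keys m \<subseteq> entries n"
    by (auto simp: \<pi>(2) keys_term_monomial)
qed

text \<open>
  The signs that distinguish \<open>generic_minor\<close> from the plain minors are units, so these
  combinations are the elements of \<open>I_ideal n\<close> (\<open>generic_minor_in_I\<close> and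
  \<open>in_I_idealE\<close>).
\<close>

definition minor_combinations :: "nat \<Rightarrow> 'k::field xpol set"
  where "minor_combinations n = {\<Sum>j = 1..n+1. c j * generic_minor n j | c. \<forall>j. c j \<in> carrier (mpoly_ring (entries n))}"

lemma maximal_minors_closed: "maximal_minors (X_mat n :: 'k::field xpol mat) \<subseteq> carrier (mpoly_ring (entries n))"
  by (auto simp: maximal_minors_X_mat)

lemma ideal_I_ideal: "ideal (I_ideal n :: 'k::field xpol set) (mpoly_ring (entries n))"
  unfolding I_ideal_def Q_ring_eq
  by (rule ring.genideal_ideal[OF cring.axioms(1)[OF cring_mpoly_ring] maximal_minors_closed])

interpretation gen: affine_algebra "entries n" "I_ideal n :: 'k::field xpol set" for n
  by (rule affine_algebra.intro[OF _ ideal_I_ideal]) (simp add: entries_def)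

lemma generic_minor_in_I:
  assumes "j \<in> {1..n+1}"
  shows "(generic_minor n j :: 'k::field xpol) \<in> I_ideal n"
proof -
  have "maximal_minors (X_mat n :: 'k xpol mat) \<subseteq> I_ideal n"
    unfolding I_ideal_def Q_ring_eq
    by (rule ring.genideal_self[OF cring.axioms(1)[OF cring_mpoly_ring] maximal_minors_closed])
  then have "(-1) ^ (j - 1) * (generic_minor n j :: 'k xpol) \<in> I_ideal n"
    using assms by (auto simp: maximal_minors_X_mat)
  then have "(-1) ^ (j - 1) * ((-1) ^ (j - 1) * (generic_minor n j :: 'k xpol)) \<in> I_ideal n"
    by (rule gen.I_mult) simp
  then show ?thesis by (simp add: mult.assoc[symmetric] power_add[symmetric])
qed

lemma ideal_minor_combinations:
  "ideal (minor_combinations n :: 'k::field xpol set) (mpoly_ring (entries n))"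
proof -
  let ?Q = "mpoly_ring (entries n) :: 'k xpol ring"
  have elim: thesis
    if "f \<in> minor_combinations n" "\<And>c. \<lbrakk>\<And>j. c j \<in> carrier ?Q; f = (\<Sum>j = 1..n+1. c j * generic_minor n j)\<rbrakk> \<Longrightarrow> thesis"
    for f thesis using that by (auto simp: minor_combinations_def)
  have intro: "(\<Sum>j = 1..n+1. c j * generic_minor n j) \<in> minor_combinations n"
    if "\<And>j. c j \<in> carrier ?Q" for c using that by (auto simp: minor_combinations_def)
  have closed: "f \<in> carrier ?Q" if "f \<in> minor_combinations n" for f
    using that by (rule elim) (auto intro!: mpoly_sum_closed mpoly_mult_closed)
  have mult: "x * f \<in> minor_combinations n" if "f \<in> minor_combinations n" "x \<in> carrier ?Q" for f x
    using that(1)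
  proof (rule elim)
    fix c assume c: "\<And>j. c j \<in> carrier ?Q" "f = (\<Sum>j = 1..n+1. c j * generic_minor n j)"
    then show ?thesis using intro[of "\<lambda>j. x * c j"] that(2)
      by (simp add: sum_distrib_left mult.assoc)
  qed
  have add: "f + g \<in> minor_combinations n"
    if f: "f \<in> minor_combinations n" and g: "g \<in> minor_combinations n" for f g :: "'k xpol"
  proof -
    obtain c where c: "\<And>j. c j \<in> carrier ?Q" "f = (\<Sum>j = 1..n+1. c j * generic_minor n j)"
      by (rule elim[OF f]) (rule that)
    obtain d where d: "\<And>j. d j \<in> carrier ?Q" "g = (\<Sum>j = 1..n+1. d j * generic_minor n j)"
      by (rule elim[OF g]) (rule that)
    show ?thesis using intro[of "\<lambda>j. c j + d j"] c d by (simp add: distrib_right sum.distrib)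
  qed
  have zero: "0 \<in> (minor_combinations n :: 'k xpol set)" using intro[of "\<lambda>_. 0"] by simp
  interpret Q: cring ?Q by (rule cring_mpoly_ring)
  show ?thesis
  proof (rule idealI)
    show "subgroup (minor_combinations n) (add_monoid ?Q)"
    proof (rule Q.add.subgroupI)
      fix f :: "'k xpol" assume f: "f \<in> minor_combinations n"
      have "\<ominus>\<^bsub>?Q\<^esub> f = (-1) * f"
        by (rule Q.minus_equality) (use closed[OF f] in auto)
      then show "\<ominus>\<^bsub>?Q\<^esub> f \<in> minor_combinations n"
        using mult[OF f, of "-1"] by simp
    next
      show "minor_combinations n \<noteq> ({} :: 'k xpol set)" using zero by blast
    qed (auto intro: closed add)
  next
    fix f x :: "'k xpol" assume "f \<in> minor_combinations n" "x \<in> carrier ?Q"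
    then show "x \<otimes>\<^bsub>?Q\<^esub> f \<in> minor_combinations n" "f \<otimes>\<^bsub>?Q\<^esub> x \<in> minor_combinations n"
      using mult[of f x] by (simp_all add: mult.commute)
  qed (rule Q.ring_axioms)
qed

lemma in_I_idealE:
  assumes "f \<in> (I_ideal n :: 'k::field xpol set)"
  obtains c where "\<And>j. c j \<in> carrier (mpoly_ring (entries n))"
    "f = (\<Sum>j = 1..n+1. c j * generic_minor n j)"
proof -
  have "maximal_minors (X_mat n :: 'k xpol mat) \<subseteq> minor_combinations n"
  proof
    fix f assume "f \<in> maximal_minors (X_mat n :: 'k xpol mat)"
    then obtain l where l: "l \<in> {1..n+1}" "f = (-1) ^ (l - 1) * generic_minor n l"
      by (auto simp: maximal_minors_X_mat)
    define c :: "nat \<Rightarrow> 'k xpol" where "c = (\<lambda>j. if j = l then (-1) ^ (l - 1) else 0)"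
    have "f = (\<Sum>j = 1..n+1. c j * generic_minor n j)"
      using l by (simp add: c_def if_distrib[of "\<lambda>x. x * _"] cong: if_cong)
    moreover have "c j \<in> carrier (mpoly_ring (entries n))" for j
      unfolding c_def by simp
    ultimately show "f \<in> minor_combinations n" by (auto simp: minor_combinations_def)
  qed
  then have "I_ideal n \<subseteq> (minor_combinations n :: 'k xpol set)"
    unfolding I_ideal_def Q_ring_eq
    by (rule ring.genideal_minimal[OF cring.axioms(1)[OF cring_mpoly_ring] ideal_minor_combinations])
  then show ?thesis using assms that by (auto simp: minor_combinations_def)
qed

text \<open>Apply the vector field to the row relation \<open>X \<Delta> = 0\<close>.\<close>

lemma row_relation_under_vector_field:
  fixes A :: "nat \<times> nat \<Rightarrow> 'k::field xpol"
  assumes "k \<in> {1..n}"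
  shows "(\<Sum>j = 1..n+1. A (k, j) * generic_minor n j)
    + (\<Sum>j = 1..n+1. xv k j * vector_field (entries n) A (generic_minor n j)) = 0"
proof -
  let ?D = "vector_field (entries n) A"
  have "?D (\<Sum>j = 1..n+1. xv k j * generic_minor n j) = 0"
    unfolding rows_annihilate_minors[OF assms, where X = xv] by (rule vector_field_zero)
  moreover have "?D (\<Sum>j = 1..n+1. xv k j * generic_minor n j)
      = (\<Sum>j = 1..n+1. A (k, j) * generic_minor n j + xv k j * ?D (generic_minor n j))"
    unfolding vector_field_sum vector_field_mult
    by (intro sum.cong refl) (use assms in \<open>simp add: vector_field_Var entries_def\<close>)
  ultimately show ?thesis by (simp only: sum.distrib)
qed

text \<open>
  If \<open>A = P X - X T\<close>, the differentiated row relations say that \<open>w = D(\<Delta>)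
  - T \<Delta>\<close> lies in the kernel of \<open>X\<close>, so \<open>w\<close> is a multiple of
  \<open>\<Delta>\<close> and \<open>D(\<Delta>)\<close> has entries in \<open>I_ideal n\<close>.
\<close>

theorem logarithmic_of_row_column_action:
  fixes A :: "nat \<times> nat \<Rightarrow> 'k::field xpol"
  assumes A: "\<And>k l. \<lbrakk>k \<in> {1..n}; l \<in> {1..n+1}\<rbrakk>
      \<Longrightarrow> A (k, l) = (\<Sum>r = 1..n. P k r * xv r l) - (\<Sum>m = 1..n+1. xv k m * T m l)"
    and P: "\<And>k r. P k r \<in> carrier (mpoly_ring (entries n))"
    and T: "\<And>m l. T m l \<in> carrier (mpoly_ring (entries n))"
  shows "gen.logarithmic n A"
proof -
  let ?D = "vector_field (entries n) A" and ?Q = "mpoly_ring (entries n) :: 'k xpol ring"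
  let ?\<Delta> = "generic_minor n :: nat \<Rightarrow> 'k xpol"
  have AQ: "A \<in> entries n \<rightarrow> carrier ?Q"
  proof
    fix v assume "v \<in> entries n"
    then obtain k l where v: "v = (k, l)" "k \<in> {1..n}" "l \<in> {1..n+1}" by (cases v) auto
    show "A v \<in> carrier ?Q"
      unfolding v(1) A[OF v(2,3)]
      using v by (intro mpoly_diff_closed mpoly_sum_closed mpoly_mult_closed P T) auto
  qed
  define w where "w = (\<lambda>m. ?D (?\<Delta> m) - (\<Sum>j = 1..n+1. T m j * ?\<Delta> j))"
  have "(\<Sum>m = 1..n+1. xv k m * w m) = 0" if k: "k \<in> {1..n}" for k
  proof -
    have "(\<Sum>j = 1..n+1. A (k, j) * ?\<Delta> j)
        = (\<Sum>j = 1..n+1. \<Sum>r = 1..n. P k r * (xv r j * ?\<Delta> j))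
          - (\<Sum>j = 1..n+1. \<Sum>m = 1..n+1. xv k m * (T m j * ?\<Delta> j))"
      unfolding sum_subtractf[symmetric]
      by (intro sum.cong refl)
        (use k in \<open>simp only: A left_diff_distrib sum_distrib_right mult.assoc\<close>)
    also have "(\<Sum>j = 1..n+1. \<Sum>r = 1..n. P k r * (xv r j * ?\<Delta> j))
        = (\<Sum>r = 1..n. P k r * (\<Sum>j = 1..n+1. xv r j * ?\<Delta> j))"
      by (subst sum.swap) (simp only: sum_distrib_left)
    also have "\<dots> = 0"
      by (intro sum.neutral ballI) (simp only: rows_annihilate_minors[where X = xv] mult_zero_right)
    also have "(\<Sum>j = 1..n+1. \<Sum>m = 1..n+1. xv k m * (T m j * ?\<Delta> j))
        = (\<Sum>m = 1..n+1. xv k m * (\<Sum>j = 1..n+1. T m j * ?\<Delta> j))"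
      by (subst sum.swap) (simp only: sum_distrib_left)
    finally show ?thesis
      using row_relation_under_vector_field[OF k, of A]
      by (simp add: w_def right_diff_distrib sum_subtractf)
  qed
  then have "\<exists>c. \<forall>m \<in> {1..n+1}. w m = c * ?\<Delta> m"
    by (rule kernel_multiple_of_minors[OF coprime_minors_generic])
  then obtain c where c: "\<And>m. m \<in> {1..n+1} \<Longrightarrow> w m = c * ?\<Delta> m" by blast
  have minor: "?D (?\<Delta> m) \<in> I_ideal n" if m: "m \<in> {1..n+1}" for m
  proof -
    have DQ: "?D (?\<Delta> m) \<in> carrier ?Q" using m AQ by simp
    have "?D (?\<Delta> m) = (\<Sum>j = 1..n+1. T m j * ?\<Delta> j) + c * ?\<Delta> m"
      using c[OF m] by (simp add: w_def algebra_simps)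
    then have "restrict_vars (entries n) (?D (?\<Delta> m))
        = restrict_vars (entries n) (\<Sum>j = 1..n+1. T m j * ?\<Delta> j) + restrict_vars (entries n) c * ?\<Delta> m"
      using m by (simp only: restrict_vars_add restrict_vars_mult generic_minor_closed)
    also have "restrict_vars (entries n) (?D (?\<Delta> m)) = ?D (?\<Delta> m)"
      by (rule restrict_vars_id[OF DQ])
    also have "restrict_vars (entries n) (\<Sum>j = 1..n+1. T m j * ?\<Delta> j) = (\<Sum>j = 1..n+1. T m j * ?\<Delta> j)"
      by (rule restrict_vars_id) (intro mpoly_sum_closed mpoly_mult_closed T generic_minor_closed)
    also have "\<dots> + restrict_vars (entries n) c * ?\<Delta> m \<in> I_ideal n"
      using m T by (intro gen.I_add gen.I_sum gen.I_mult generic_minor_in_I restrict_vars_closed) auto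
    finally show ?thesis .
  qed
  have "?D f \<in> I_ideal n" if f: "f \<in> I_ideal n" for f
  proof -
    obtain c where c: "\<And>j. c j \<in> carrier ?Q" "f = (\<Sum>j = 1..n+1. c j * ?\<Delta> j)"
      by (rule in_I_idealE[OF f]) (rule that)
    then have "?D f = (\<Sum>j = 1..n+1. ?D (c j) * ?\<Delta> j + c j * ?D (?\<Delta> j))"
      by (simp only: vector_field_sum vector_field_mult)
    also have "\<dots> \<in> I_ideal n"
      using c(1) AQ by (intro gen.I_sum gen.I_add gen.I_mult generic_minor_in_I minor) auto
    finally show ?thesis .
  qed
  then show ?thesis using AQ by (auto simp: gen.logarithmic_def)
qed

text \<open>
  Writing \<open>D(\<Delta>) = T \<Delta>\<close> turns the differentiated row relations into
  syzygies: every row of \<open>A + X T\<close> is a syzygy of the minors, thus a combination of the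
  rows of \<open>X\<close>.
\<close>

theorem logarithmic_imp_row_column_action:
  fixes A :: "nat \<times> nat \<Rightarrow> 'k::field xpol"
  assumes A: "gen.logarithmic n A"
  obtains P T where
    "\<And>k l. \<lbrakk>k \<in> {1..n}; l \<in> {1..n+1}\<rbrakk>
      \<Longrightarrow> A (k, l) = (\<Sum>r = 1..n. P k r * xv r l) - (\<Sum>m = 1..n+1. xv k m * T m l)"
    "\<And>k r. P k r \<in> carrier (mpoly_ring (entries n))"
    "\<And>m l. T m l \<in> carrier (mpoly_ring (entries n))"
proof -
  let ?D = "vector_field (entries n) A" and ?Q = "mpoly_ring (entries n) :: 'k xpol ring"
  let ?\<Delta> = "generic_minor n :: nat \<Rightarrow> 'k xpol"
  have "\<forall>m. \<exists>t. (\<forall>j. t j \<in> carrier ?Q) \<and> (m \<in> {1..n+1} \<longrightarrow> ?D (?\<Delta> m) = (\<Sum>j = 1..n+1. t j * ?\<Delta> j))"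
  proof
    fix m
    show "\<exists>t. (\<forall>j. t j \<in> carrier ?Q) \<and> (m \<in> {1..n+1} \<longrightarrow> ?D (?\<Delta> m) = (\<Sum>j = 1..n+1. t j * ?\<Delta> j))"
    proof (cases "m \<in> {1..n+1}")
      case True
      then have "?D (?\<Delta> m) \<in> I_ideal n"
        by (intro gen.logarithmicD(3)[OF A] generic_minor_in_I)
      then show ?thesis by (rule in_I_idealE) blast
    next
      case False
      then show ?thesis by (intro exI[of _ "\<lambda>_. 0"]) auto
    qed
  qed
  from choice[OF this] obtain T where T: "\<And>m j. T m j \<in> carrier ?Q"
    and DT: "\<And>m. m \<in> {1..n+1} \<Longrightarrow> ?D (?\<Delta> m) = (\<Sum>j = 1..n+1. T m j * ?\<Delta> j)" by blast
  have "\<exists>c. \<forall>l \<in> {1..n+1}. A (k, l) + (\<Sum>m = 1..n+1. xv k m * T m l) = (\<Sum>r = 1..n. c r * xv r l)"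
    if k: "k \<in> {1..n}" for k
  proof -
    have "(\<Sum>j = 1..n+1. (A (k, j) + (\<Sum>m = 1..n+1. xv k m * T m j)) * ?\<Delta> j)
        = (\<Sum>j = 1..n+1. A (k, j) * ?\<Delta> j) + (\<Sum>j = 1..n+1. \<Sum>m = 1..n+1. xv k m * (T m j * ?\<Delta> j))"
      by (simp only: distrib_right sum.distrib sum_distrib_right mult.assoc)
    also have "(\<Sum>j = 1..n+1. \<Sum>m = 1..n+1. xv k m * (T m j * ?\<Delta> j))
        = (\<Sum>m = 1..n+1. xv k m * ?D (?\<Delta> m))"
      by (subst sum.swap) (simp only: sum_distrib_left[symmetric] DT cong: sum.cong)
    finally have "(\<Sum>j = 1..n+1. (A (k, j) + (\<Sum>m = 1..n+1. xv k m * T m j)) * ?\<Delta> j) = 0"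
      by (simp only: row_relation_under_vector_field[OF k, of A])
    then show ?thesis by (rule syzygy_in_row_space[OF coprime_minors_generic])
  qed
  then have "\<forall>k. \<exists>c. k \<in> {1..n} \<longrightarrow>
      (\<forall>l \<in> {1..n+1}. A (k, l) + (\<Sum>m = 1..n+1. xv k m * T m l) = (\<Sum>r = 1..n. c r * xv r l))"
    by blast
  from choice[OF this] obtain P where P: "\<And>k l. \<lbrakk>k \<in> {1..n}; l \<in> {1..n+1}\<rbrakk> \<Longrightarrow>
      A (k, l) + (\<Sum>m = 1..n+1. xv k m * T m l) = (\<Sum>r = 1..n. P k r * xv r l)" by blast
  show ?thesis
  proof (rule that)
    fix k l assume kl: "k \<in> {1..n}" "l \<in> {1..n+1}"
    have "A (k, l) + (\<Sum>m = 1..n+1. xv k m * T m l)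
        = restrict_vars (entries n) (A (k, l) + (\<Sum>m = 1..n+1. xv k m * T m l))"
      using kl by (intro restrict_vars_id[symmetric] mpoly_add_closed mpoly_sum_closed mpoly_mult_closed
          T gen.logarithmicD(2)[OF A]) auto
    also have "\<dots> = (\<Sum>r = 1..n. restrict_vars (entries n) (P k r) * xv r l)"
      unfolding P[OF kl] restrict_vars_sum
      by (intro sum.cong refl restrict_vars_mult) (use kl in auto)
    finally show "A (k, l) = (\<Sum>r = 1..n. restrict_vars (entries n) (P k r) * xv r l)
        - (\<Sum>m = 1..n+1. xv k m * T m l)" by (simp add: algebra_simps)
  qed (auto intro: T)
qed

section \<open>The generators\<close>

lemma R_ring_eq: "R_ring n = mpoly_ring (entries n) Quot I_ideal n"
  by (simp only: R_ring_def Q_ring_eq)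

lemma Der_R_eq:
  "Der_R n = Der (gen.R n) (gen.scal n :: 'k::field \<Rightarrow> 'k xpol set)"
proof -
  have "R_const n = (gen.scal n :: 'k \<Rightarrow> 'k xpol set)"
    by (simp add: fun_eq_iff R_const_def Q_ring_eq)
  then show ?thesis by (simp only: Der_R_def R_ring_eq)
qed

text \<open>
  A vector field is recorded by its coefficients, a matrix indexed by the variables. Here row
  \<open>s\<close> is row \<open>r\<close> of \<open>X\<close> and all other rows vanish: the
  tangent direction of adding a multiple of row \<open>r\<close> to row \<open>s\<close>.
\<close>

definition row_op :: "nat \<Rightarrow> nat \<Rightarrow> nat \<times> nat \<Rightarrow> 'k::field xpol"
  where "row_op r s = (\<lambda>(k, l). if k = s then xv r l else 0)"

text \<open>
  The tangent direction of adding a multiple of column \<open>j\<close> to column \<open>i\<close>.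
\<close>

definition col_op :: "nat \<Rightarrow> nat \<Rightarrow> nat \<times> nat \<Rightarrow> 'k::field xpol"
  where "col_op i j = (\<lambda>(k, l). if l = i then xv k j else 0)"

definition B_op :: "nat \<Rightarrow> nat \<times> nat \<Rightarrow> 'k::field xpol"
  where "B_op m v = row_op m m v - row_op 1 1 v"

text \<open>
  The two sums in the diagonal case of \<open>L_der\<close> are the Euler fields of row
  \<open>1\<close> and of column \<open>i\<close>, each without the variable
  \<open>x\<^bsub>1,i\<^esub>\<close> where they meet and cancel.
\<close>

definition L_op :: "nat \<Rightarrow> nat \<Rightarrow> nat \<times> nat \<Rightarrow> 'k::field xpol"
  where "L_op i j v = (if i = j then (-1) ^ (i + 1) * (row_op 1 1 v - col_op i i v)
    else (-1) ^ j * col_op i j v)"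

lemma vector_field_diff_coeff:
  "vector_field W (\<lambda>v. A v - B v) f = vector_field W A f - vector_field W B f"
  by (simp add: vector_field_def left_diff_distrib sum_subtractf)

lemma vector_field_row_op:
  assumes "s \<in> {1..n}"
  shows "vector_field (entries n) (row_op r s) f = V_der n r s f"
proof -
  have "vector_field (entries n) (row_op r s) f
      = (\<Sum>k = 1..n. \<Sum>l = 1..n+1. row_op r s (k, l) * partial_deriv (k, l) f)"
    unfolding vector_field_def entries_def sum.cartesian_product by simp
  also have "\<dots> = (\<Sum>k = 1..n. if k = s then V_der n r s f else 0)"
    by (intro sum.cong refl) (simp add: row_op_def V_der_def)
  finally show ?thesis using assms by simp
qed

lemma vector_field_col_op:
  assumes "i \<in> {1..n+1}"
  shows "vector_field (entries n) (col_op i j) f = (\<Sum>k = 1..n. xv k j * partial_deriv (k, i) f)"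
proof -
  have "vector_field (entries n) (col_op i j) f
      = (\<Sum>k = 1..n. \<Sum>l = 1..n+1. col_op i j (k, l) * partial_deriv (k, l) f)"
    unfolding vector_field_def entries_def sum.cartesian_product by simp
  also have "\<dots> = (\<Sum>k = 1..n. \<Sum>l = 1..n+1. if l = i then xv k j * partial_deriv (k, i) f else 0)"
    by (intro sum.cong refl) (simp add: col_op_def)
  finally show ?thesis using assms by simp
qed

lemma vector_field_B_op:
  assumes "l \<in> {2..n}"
  shows "vector_field (entries n) (B_op l) f = B_der n l f"
  using assms vector_field_row_op[of l n l f] vector_field_row_op[of 1 n 1 f]
  unfolding B_op_def vector_field_diff_coeff by (simp add: B_der_def)

lemma vector_field_L_op:
  assumes "n \<ge> 1" "i \<in> {1..n+1}" "j \<in> {1..n+1}"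
  shows "vector_field (entries n) (L_op i j) f = L_der n i j f"
proof (cases "i = j")
  case True
  have "vector_field (entries n) (L_op i j) f
      = (-1) ^ (i + 1) * (vector_field (entries n) (row_op 1 1) f - vector_field (entries n) (col_op i i) f)"
    using True
    by (simp only: L_op_def[abs_def] if_True simp_thms vector_field_smult_coeff vector_field_diff_coeff)
  also have "vector_field (entries n) (row_op 1 1) f
      = (\<Sum>k \<in> {1..n+1} - {i}. xv 1 k * partial_deriv (1, k) f) + xv 1 i * partial_deriv (1, i) f"
    using assms by (subst vector_field_row_op) (auto simp: V_der_def sum.remove[of _ i] add.commute)
  also have "vector_field (entries n) (col_op i i) f
      = xv 1 i * partial_deriv (1, i) f + (\<Sum>l = 2..n. xv l i * partial_deriv (l, i) f)"
  proof -
    have "{1..n} = insert 1 {2..n}" using assms(1) by auto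
    then show ?thesis using assms by (simp add: vector_field_col_op)
  qed
  finally show ?thesis using True by (simp add: L_der_def)
next
  case False
  then show ?thesis using assms
    by (simp only: L_op_def[abs_def] L_der_def if_False vector_field_smult_coeff vector_field_col_op)
qed

lemma logarithmic_row_op:
  assumes "r \<in> {1..n}"
  shows "gen.logarithmic n (row_op r s :: nat \<times> nat \<Rightarrow> 'k::field xpol)"
proof (rule logarithmic_of_row_column_action)
  fix k l assume "k \<in> {1..n}" "l \<in> {1..n+1}"
  show "row_op r s (k, l) = (\<Sum>r' = 1..n. (if k = s \<and> r' = r then 1 else 0) * xv r' l)
      - (\<Sum>m = 1..n+1. xv k m * (0 :: 'k xpol))"
    using assms by (simp add: row_op_def if_distrib[of "\<lambda>x. x * _"] cong: if_cong)
qed auto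

lemma logarithmic_col_op:
  assumes "j \<in> {1..n+1}"
  shows "gen.logarithmic n (col_op i j :: nat \<times> nat \<Rightarrow> 'k::field xpol)"
proof (rule logarithmic_of_row_column_action)
  fix k l assume "k \<in> {1..n}" "l \<in> {1..n+1}"
  show "col_op i j (k, l) = (\<Sum>r = 1..n. (0 :: 'k xpol) * xv r l)
      - (\<Sum>m = 1..n+1. xv k m * (if l = i \<and> m = j then -1 else 0))"
    using assms by (simp add: col_op_def if_distrib[of "\<lambda>x. _ * x"] cong: if_cong)
qed auto

lemma logarithmic_diff:
  assumes "gen.logarithmic n A" "gen.logarithmic n B"
  shows "gen.logarithmic n (\<lambda>v. A v - B v)"
  using gen.logarithmic_add[OF assms(1) gen.logarithmic_smult[OF assms(2), of "-1"]] by simp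

lemma logarithmic_B_op:
  "m \<in> {2..n} \<Longrightarrow> gen.logarithmic n (B_op m)"
  unfolding B_op_def[abs_def] by (rule logarithmic_diff; rule logarithmic_row_op) auto

lemma logarithmic_L_op:
  assumes "n \<ge> 1" "i \<in> {1..n+1}" "j \<in> {1..n+1}"
  shows "gen.logarithmic n (L_op i j)"
proof (cases "i = j")
  case True
  have "gen.logarithmic n (\<lambda>v. (-1) ^ (i + 1) * (row_op 1 1 v - col_op i i v))"
    using assms
    by (intro gen.logarithmic_smult logarithmic_diff logarithmic_row_op logarithmic_col_op
        mpoly_minus_one_power_closed) auto
  then show ?thesis using True by (simp only: L_op_def[abs_def] if_True simp_thms)
next
  case False
  have "gen.logarithmic n (\<lambda>v. (-1) ^ j * col_op i j v)"
    using assms by (intro gen.logarithmic_smult logarithmic_col_op mpoly_minus_one_power_closed) auto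
  then show ?thesis using False by (simp only: L_op_def[abs_def] if_False)
qed

definition generators :: "nat \<Rightarrow> (nat \<times> nat \<Rightarrow> 'k::field xpol) set"
  where "generators n =
    {row_op r s | r s. r \<in> {1..n} \<and> s \<in> {1..n} \<and> r \<noteq> s}
    \<union> {B_op l | l. l \<in> {2..n}}
    \<union> {L_op i j | i j. i \<in> {1..n+1} \<and> j \<in> {1..n+1}}"

lemma generatorsI:
  shows row_op_generator: "\<lbrakk>r \<in> {1..n}; s \<in> {1..n}; r \<noteq> s\<rbrakk> \<Longrightarrow> row_op r s \<in> generators n"
    and B_op_generator: "l \<in> {2..n} \<Longrightarrow> B_op l \<in> generators n"
    and L_op_generator: "\<lbrakk>i \<in> {1..n+1}; j \<in> {1..n+1}\<rbrakk> \<Longrightarrow> L_op i j \<in> generators n"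
  unfolding generators_def by blast+

lemma generators_cases:
  assumes "A \<in> generators n"
  obtains (V) r s where "r \<in> {1..n}" "s \<in> {1..n}" "r \<noteq> s" "A = row_op r s"
    | (B) l where "l \<in> {2..n}" "A = B_op l"
    | (L) i j where "i \<in> {1..n+1}" "j \<in> {1..n+1}" "A = L_op i j"
  using assms unfolding generators_def by blast

lemma logarithmic_generators:
  "n \<ge> 1 \<Longrightarrow> A \<in> generators n \<Longrightarrow> gen.logarithmic n A"
  by (elim generators_cases) (auto intro: logarithmic_row_op logarithmic_B_op logarithmic_L_op)

lemma setcompr_image2:
  assumes "\<And>r s. P r s \<Longrightarrow> F r s = g (G r s)"
  shows "{F r s | r s. P r s} = g ` {G r s | r s. P r s}"
proof (intro equalityI subsetI)
  fix x assume "x \<in> {F r s | r s. P r s}"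
  then obtain r s where rs: "P r s" "x = F r s" by blast
  then show "x \<in> g ` {G r s | r s. P r s}"
    by (intro image_eqI[of _ _ "G r s"]) (use assms[OF rs(1)] in auto)
next
  fix x assume "x \<in> g ` {G r s | r s. P r s}"
  then obtain r s where rs: "P r s" "x = g (G r s)" by blast
  then have "x = F r s" using assms[OF rs(1)] by simp
  with rs(1) show "x \<in> {F r s | r s. P r s}" by blast
qed

lemma induced_generators:
  assumes "n \<ge> 1"
  shows "induced_R n `
      ({V_der n r s | r s. r \<in> {1..n} \<and> s \<in> {1..n} \<and> r \<noteq> s}
       \<union> {B_der n l | l. l \<in> {2..n}}
       \<union> {L_der n i j | i j. i \<in> {1..n+1} \<and> j \<in> {1..n+1}})
    = gen.induced n ` (generators n :: (nat \<times> nat \<Rightarrow> 'k::field xpol) set)"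
proof -
  let ?vf = "vector_field (entries n) :: _ \<Rightarrow> 'k xpol \<Rightarrow> 'k xpol"
  have V: "V_der n r s = ?vf (row_op r s)" if "s \<in> {1..n}" for r s
    by (rule ext) (rule vector_field_row_op[OF that, symmetric])
  have B: "B_der n l = ?vf (B_op l)" if "l \<in> {2..n}" for l
    by (rule ext) (rule vector_field_B_op[OF that, symmetric])
  have L: "L_der n i j = ?vf (L_op i j)" if "i \<in> {1..n+1}" "j \<in> {1..n+1}" for i j
    by (rule ext) (rule vector_field_L_op[OF assms that, symmetric])
  have "{V_der n r s :: 'k xpol \<Rightarrow> 'k xpol | r s. r \<in> {1..n} \<and> s \<in> {1..n} \<and> r \<noteq> s}
      = ?vf ` {row_op r s | r s. r \<in> {1..n} \<and> s \<in> {1..n} \<and> r \<noteq> s}"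
    by (rule setcompr_image2) (simp only: V)
  moreover have "{B_der n l :: 'k xpol \<Rightarrow> 'k xpol | l. l \<in> {2..n}} = ?vf ` {B_op l | l. l \<in> {2..n}}"
    using setcompr_image2[of "\<lambda>l _. l \<in> {2..n}" "\<lambda>l _. B_der n l" ?vf "\<lambda>l _. B_op l"] B by simp
  moreover have "{L_der n i j :: 'k xpol \<Rightarrow> 'k xpol | i j. i \<in> {1..n+1} \<and> j \<in> {1..n+1}}
      = ?vf ` {L_op i j | i j. i \<in> {1..n+1} \<and> j \<in> {1..n+1}}"
    by (rule setcompr_image2) (simp only: L)
  ultimately have eq: "{V_der n r s | r s. r \<in> {1..n} \<and> s \<in> {1..n} \<and> r \<noteq> s}
       \<union> {B_der n l | l. l \<in> {2..n}}
       \<union> {L_der n i j | i j. i \<in> {1..n+1} \<and> j \<in> {1..n+1}} = ?vf ` generators n"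
    by (simp only: generators_def image_Un)
  show ?thesis unfolding eq by (simp only: image_image induced_R_def Q_ring_eq)
qed

text \<open>
  Let \<open>V\<^sub>m\<close> and \<open>C\<^sub>i\<close> be the Euler fields of the rows and
  columns. Then \<open>B\<^sub>m = V\<^sub>m - V\<^sub>1\<close> and \<open>(-1)\<^bsup>i+1\<^esup>
  L\<^bsub>i,i\<^esub> = V\<^sub>1 - C\<^sub>i\<close>. In their sum \<open>\<Sum>V\<^sub>m -
  \<Sum>C\<^sub>i = 0\<close> cancels, and \<open>V\<^sub>1\<close> remains \<open>(n + 1) -
  n\<close> times.
\<close>

lemma euler_identity:
  assumes "n \<ge> 1" "v \<in> entries n"
  shows "row_op 1 1 v = (\<Sum>m = 2..n. B_op m v) + (\<Sum>i = 1..n+1. (-1) ^ (i + 1) * (L_op i i v :: 'k::field xpol))"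
proof -
  obtain k l where v: "v = (k, l)" "k \<in> {1..n}" "l \<in> {1..n+1}" using assms(2) by (cases v) auto
  have "(\<Sum>m = 2..n. B_op m v :: 'k xpol) = (\<Sum>m = 2..n. row_op m m v) - of_nat (n - 1) * row_op 1 1 v"
    by (simp add: B_op_def sum_subtractf)
  also have "(\<Sum>m = 2..n. row_op m m v :: 'k xpol) = xv k l - row_op 1 1 v"
  proof -
    have "(\<Sum>m = 2..n. row_op m m v :: 'k xpol) = (\<Sum>m = 2..n. if m = k then xv k l else 0)"
      by (intro sum.cong refl) (auto simp: row_op_def v(1))
    then show ?thesis using v by (cases "k = 1") (auto simp: row_op_def)
  qed
  finally have 1: "(\<Sum>m = 2..n. B_op m v :: 'k xpol) = xv k l - row_op 1 1 v - of_nat (n - 1) * row_op 1 1 v" .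
  have "(\<Sum>i = 1..n+1. (-1) ^ (i + 1) * (L_op i i v :: 'k xpol)) = (\<Sum>i = 1..n+1. row_op 1 1 v - col_op i i v)"
    by (intro sum.cong refl) (simp add: L_op_def mult.assoc[symmetric] power_add[symmetric])
  also have "\<dots> = of_nat (n + 1) * row_op 1 1 v - (\<Sum>i = 1..n+1. col_op i i v)"
    by (simp add: sum_subtractf)
  also have "(\<Sum>i = 1..n+1. col_op i i v :: 'k xpol) = (\<Sum>i = 1..n+1. if i = l then xv k l else 0)"
    by (intro sum.cong refl) (auto simp: col_op_def v(1))
  also have "(\<Sum>i = 1..n+1. if i = l then xv k l else 0 :: 'k xpol) = xv k l" using v by simp
  finally have 2: "(\<Sum>i = 1..n+1. (-1) ^ (i + 1) * (L_op i i v :: 'k xpol)) = of_nat (n + 1) * row_op 1 1 v - xv k l" .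
  obtain n' where "n = Suc n'" using assms(1) by (cases n) auto
  then show ?thesis unfolding 1 2 by (simp add: algebra_simps)
qed

theorem generators_span:
  assumes n: "n \<ge> 1"
  shows "LinearCombinations.module.span (gen.R n) (Der (gen.R n) (gen.scal n))
      (gen.induced n ` (generators n :: (nat \<times> nat \<Rightarrow> 'k::field xpol) set))
    = derivations (gen.R n) (gen.scal n)"
proof -
  let ?Q = "mpoly_ring (entries n) :: 'k xpol ring"
  let ?M = "Der (gen.R n) (gen.scal n :: 'k \<Rightarrow> _)"
  let ?S = "gen.induced n ` (generators n :: (nat \<times> nat \<Rightarrow> 'k xpol) set)"
  interpret M: module "gen.R n" ?M by (rule gen.module_Der_R)
  have S: "?S \<subseteq> carrier ?M"
    using gen.induced_in_Der[OF logarithmic_generators[OF n]] by auto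
  have sub: "submodule (gen.R n) (M.span ?S) ?M" by (rule M.span_is_submodule[OF S])
  \<comment> \<open>The coefficient matrices whose induced derivations lie in the span form a module over the polynomial ring, so it is enough to find all row and column operations among them.\<close>
  define good where "good A \<longleftrightarrow> gen.logarithmic n A \<and> gen.induced n A \<in> M.span ?S"
    for A :: "nat \<times> nat \<Rightarrow> 'k xpol"
  have good_generator: "good A" if "A \<in> generators n" for A
    using logarithmic_generators[OF n that] M.in_own_span[OF S] that by (auto simp: good_def)
  have good_add: "good (\<lambda>v. A v + B v)" if "good A" "good B" for A B
    using that submodule.m_closed[OF sub]
    by (simp add: good_def gen.logarithmic_add gen.induced_add del: Der_simps)
  have good_smult: "good (\<lambda>v. g * A v)" if "good A" "g \<in> carrier ?Q" for A g
    using that submodule.smult_closed[OF sub]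
    by (simp add: good_def gen.logarithmic_smult gen.induced_smult del: Der_simps)
  have good_zero: "good (\<lambda>_. 0)"
    using submodule.zero_closed[OF sub]
    by (simp add: good_def gen.logarithmic_zero gen.induced_zero del: Der_simps)
  have good_sum: "good (\<lambda>v. \<Sum>i \<in> F. A i v)" if "finite F" "\<And>i. i \<in> F \<Longrightarrow> good (A i)"
    for F :: "nat set" and A
    using that by (induction F rule: finite_induct) (auto intro: good_zero good_add)
  have good_diff: "good (\<lambda>v. A v - B v)" if "good A" "good B" for A B
    using good_add[OF that(1) good_smult[OF that(2), of "-1"]] by simp
  have good_cong: "good B" if "good A" "\<And>v. v \<in> entries n \<Longrightarrow> A v = B v" for A B
  proof -
    have "vector_field (entries n) A = vector_field (entries n) B"
      using that(2) by (simp add: fun_eq_iff vector_field_def)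
    moreover have "A \<in> entries n \<rightarrow> carrier ?Q \<longleftrightarrow> B \<in> entries n \<rightarrow> carrier ?Q"
      using that(2) by (auto simp: Pi_def)
    ultimately show ?thesis using that(1) by (simp add: good_def gen.logarithmic_def)
  qed
  have sign_sign: "(-1) ^ i * ((-1) ^ i * x) = (x :: 'k xpol)" for i x
    by (simp add: mult.assoc[symmetric] power_add[symmetric])
  have L: "good (L_op i j)" if "i \<in> {1..n+1}" "j \<in> {1..n+1}" for i j
    using that by (intro good_generator L_op_generator)
  have B: "good (B_op l)" if "l \<in> {2..n}" for l
    using that by (intro good_generator B_op_generator)
  have V11: "good (row_op 1 1)"
  proof (rule good_cong)
    show "good (\<lambda>v. (\<Sum>m = 2..n. B_op m v) + (\<Sum>i = 1..n+1. (-1) ^ (i + 1) * L_op i i v))"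
      by (intro good_add good_sum good_smult B L) auto
  qed (simp only: euler_identity[OF n])
  have rows: "good (row_op r s)" if rs: "r \<in> {1..n}" "s \<in> {1..n}" for r s
  proof -
    consider "r \<noteq> s" | "r = s" "s = 1" | "r = s" "s \<in> {2..n}" using rs by force
    then show ?thesis
    proof cases
      case 1
      then show ?thesis using rs by (intro good_generator row_op_generator)
    next
      case 2
      then show ?thesis using V11 by simp
    next
      case 3
      then have "good (\<lambda>v. B_op s v + row_op 1 1 v)" by (intro good_add B V11)
      then show ?thesis using 3 by (simp add: B_op_def)
    qed
  qed
  have cols: "good (col_op i j)" if ij: "i \<in> {1..n+1}" "j \<in> {1..n+1}" for i j
  proof (cases "i = j")
    case True
    have "good (\<lambda>v. row_op 1 1 v - (-1) ^ (i + 1) * L_op i i v)"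
      using ij by (intro good_diff V11 good_smult L) auto
    then show ?thesis using True by (simp only: L_op_def sign_sign if_True simp_thms) simp
  next
    case False
    have "good (\<lambda>v. (-1) ^ j * L_op i j v)" using ij by (intro good_smult L) auto
    then show ?thesis using False by (simp only: L_op_def sign_sign if_False)
  qed
  have all: "good A" if A: "gen.logarithmic n A" for A
  proof -
    obtain P T where PT: "\<And>k l. \<lbrakk>k \<in> {1..n}; l \<in> {1..n+1}\<rbrakk>
        \<Longrightarrow> A (k, l) = (\<Sum>r = 1..n. P k r * xv r l) - (\<Sum>m = 1..n+1. xv k m * T m l)"
      and P: "\<And>k r. P k r \<in> carrier ?Q" and T: "\<And>m l. T m l \<in> carrier ?Q"
      by (rule logarithmic_imp_row_column_action[OF A]) (rule that)
    show ?thesis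
    proof (rule good_cong)
      show "good (\<lambda>v. (\<Sum>s = 1..n. \<Sum>r = 1..n. P s r * row_op r s v)
          - (\<Sum>i = 1..n+1. \<Sum>m = 1..n+1. T m i * col_op i m v))"
        by (intro good_diff good_sum good_smult rows cols P T) auto
      fix v assume "v \<in> entries n"
      then obtain k l where v: "v = (k, l)" and kl: "k \<in> {1..n}" "l \<in> {1..n+1}" by (cases v) auto
      have "(\<Sum>s = 1..n. \<Sum>r = 1..n. P s r * row_op r s v)
          = (\<Sum>s = 1..n. if s = k then \<Sum>r = 1..n. P k r * xv r l else 0)"
        by (intro sum.cong refl) (simp add: row_op_def v)
      moreover have "(\<Sum>i = 1..n+1. \<Sum>m = 1..n+1. T m i * col_op i m v)
          = (\<Sum>i = 1..n+1. if i = l then \<Sum>m = 1..n+1. xv k m * T m l else 0)"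
        by (intro sum.cong refl) (simp add: col_op_def v mult.commute)
      ultimately show "(\<Sum>s = 1..n. \<Sum>r = 1..n. P s r * row_op r s v)
          - (\<Sum>i = 1..n+1. \<Sum>m = 1..n+1. T m i * col_op i m v) = A v"
        using kl by (simp add: v PT[OF kl])
    qed
  qed
  have "derivations (gen.R n) (gen.scal n) \<subseteq> M.span ?S"
  proof
    fix \<delta> assume "\<delta> \<in> derivations (gen.R n) (gen.scal n :: 'k \<Rightarrow> _)"
    then obtain A where "gen.logarithmic n A" "\<delta> = gen.induced n A"
      by (rule gen.derivation_lifts)
    then show "\<delta> \<in> M.span ?S" using all by (simp add: good_def)
  qed
  then show ?thesis using M.span_is_subset2[OF S] by auto
qed

section \<open>Minimality\<close>

lemma lookup_zero_mult:
  fixes f g :: "('v, 'k::comm_ring_1) mpol"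
  shows "Poly_Mapping.lookup (f * g) 0 = Poly_Mapping.lookup f 0 * Poly_Mapping.lookup g 0"
proof (induction f rule: poly_mapping_additive_induct)
  case (single m c)
  show ?case
  proof (induction g rule: poly_mapping_additive_induct)
    case (single m' c')
    have "m + m' = 0 \<longleftrightarrow> m = 0 \<and> m' = 0"
      by (auto simp: poly_mapping_eq_iff fun_eq_iff lookup_add)
    then show ?case by (auto simp: mult_single lookup_single when_def)
  qed (auto simp: lookup_add algebra_simps)
qed (auto simp: lookup_add algebra_simps)

text \<open>
  This is \<open>\<partial>f/\<partial>v\<close> at the origin, which explains the product rule
  below.
\<close>

definition linear_coeff :: "'v \<Rightarrow> ('v, 'k::comm_ring_1) mpol \<Rightarrow> 'k"
  where "linear_coeff v f = Poly_Mapping.lookup f (Poly_Mapping.single v 1)"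

lemma linear_coeff_partial_deriv: "linear_coeff v f = Poly_Mapping.lookup (partial_deriv v f) 0"
  by (simp add: linear_coeff_def lookup_partial_deriv)

lemma linear_coeff_mult:
  "linear_coeff v (f * g) = linear_coeff v f * Poly_Mapping.lookup g 0 + Poly_Mapping.lookup f 0 * linear_coeff v g"
  by (simp add: linear_coeff_partial_deriv partial_deriv_mult lookup_add lookup_zero_mult)

lemma linear_coeff_simps [simp]:
  "linear_coeff v 0 = 0"
  "linear_coeff v (f + g) = linear_coeff v f + linear_coeff v g"
  "linear_coeff v (f - g) = linear_coeff v f - linear_coeff v g"
  "linear_coeff v (Var u) = (if u = v then 1 else 0)"
  "linear_coeff v ((-1) ^ i * f) = (-1) ^ i * linear_coeff v f"
proof -
  have "Poly_Mapping.single u (1::nat) = Poly_Mapping.single v 1 \<longleftrightarrow> u = v"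
    by (metis keys_single singleton_inject zero_neq_one)
  then show "linear_coeff v (Var u) = (if u = v then 1 else 0)"
    by (simp add: linear_coeff_def Var_def lookup_single when_def)
  show "linear_coeff v ((-1) ^ i * f) = (-1) ^ i * linear_coeff v f"
    by (cases "even i") (auto simp: linear_coeff_def)
qed (simp_all add: linear_coeff_def lookup_add lookup_minus)

text \<open>
  The minors are homogeneous of degree \<open>n\<close>. For \<open>n = 1\<close> the ideal contains
  the variables and the statement on linear coefficients fails.
\<close>

lemma I_ideal_order_two:
  assumes "n \<ge> 2" and f: "f \<in> (I_ideal n :: 'k::field xpol set)"
  shows "Poly_Mapping.lookup f 0 = 0" "linear_coeff v f = 0"
proof -
  have \<Delta>: "Poly_Mapping.lookup (generic_minor n j :: 'k xpol) m = 0" if "weight (\<lambda>_. 1) m < 2" for m j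
    using generic_minor_order[of m n j, where 'k = 'k] that assms(1) by (force simp: in_keys_iff)
  have 0: "Poly_Mapping.lookup (generic_minor n j :: 'k xpol) 0 = 0" for j by (rule \<Delta>) simp
  have 1: "linear_coeff v (generic_minor n j :: 'k xpol) = 0" for j
    unfolding linear_coeff_def by (rule \<Delta>) simp
  obtain c where c: "f = (\<Sum>j = 1..n+1. c j * generic_minor n j)" using f by (rule in_I_idealE)
  have "linear_coeff v (\<Sum>j \<in> F. c j * generic_minor n j) = 0" for F :: "nat set"
    by (induction F rule: infinite_finite_induct) (simp_all add: linear_coeff_mult 0 1)
  then show "linear_coeff v f = 0" by (simp only: c)
  show "Poly_Mapping.lookup f 0 = 0" by (simp only: c lookup_sum lookup_zero_mult 0) simp
qed

lemma linear_coeff_row_op: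
  "linear_coeff (a, b) (row_op r s (k, l)) = (if k = s \<and> a = r \<and> b = l then 1 else 0)"
  and linear_coeff_col_op:
  "linear_coeff (a, b) (col_op i j (k, l)) = (if l = i \<and> a = k \<and> b = j then 1 else 0)"
  by (auto simp: row_op_def col_op_def)

lemma linear_coeff_B_op:
  "linear_coeff u (B_op m v) = linear_coeff u (row_op m m v) - linear_coeff u (row_op 1 1 v)"
  and linear_coeff_L_op:
  "linear_coeff u (L_op i j v) = (if i = j
    then (-1) ^ (i + 1) * (linear_coeff u (row_op 1 1 v) - linear_coeff u (col_op i i v))
    else (-1) ^ j * linear_coeff u (col_op i j v))"
  by (simp only: B_op_def linear_coeff_simps)
    (cases "i = j"; simp only: L_op_def if_True if_False simp_thms linear_coeff_simps)

lemma lookup_zero_generator: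
  assumes "A \<in> (generators n :: (nat \<times> nat \<Rightarrow> 'k::field xpol) set)"
  shows "Poly_Mapping.lookup (A v) 0 = 0"
proof -
  have 0: "Poly_Mapping.lookup (Var u :: 'k xpol) 0 = 0" for u
    by (simp add: Var_def lookup_single when_def poly_mapping_eq_iff fun_eq_iff)
  have rc: "Poly_Mapping.lookup (row_op r s v :: 'k xpol) 0 = 0" "Poly_Mapping.lookup (col_op i j v :: 'k xpol) 0 = 0" for r s i j
    by (auto simp: row_op_def col_op_def 0 split: prod.split)
  show ?thesis
    using assms by (rule generators_cases) (auto simp: rc B_op_def L_op_def lookup_minus lookup_zero_mult)
qed

text \<open>
  A vector field with linear coefficients is a square matrix indexed by the variables; this is the
  sum of the entries of that matrix at the positions \<open>(p t, q t)\<close>.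
\<close>

definition entry_sum :: "nat set \<Rightarrow> (nat \<Rightarrow> nat \<times> nat) \<Rightarrow> (nat \<Rightarrow> nat \<times> nat) \<Rightarrow> (nat \<times> nat \<Rightarrow> 'k::field xpol) \<Rightarrow> 'k"
  where "entry_sum J p q A = (\<Sum>t \<in> J. linear_coeff (q t) (A (p t)))"

lemma entry_sum_generators:
  shows entry_sum_B: "entry_sum J p q (B_op m :: _ \<Rightarrow> 'k::field xpol) = entry_sum J p q (row_op m m :: _ \<Rightarrow> 'k xpol) - entry_sum J p q (row_op 1 1 :: _ \<Rightarrow> 'k xpol)"
    and entry_sum_L: "i \<noteq> j \<Longrightarrow> entry_sum J p q (L_op i j :: _ \<Rightarrow> 'k xpol) = (-1) ^ j * entry_sum J p q (col_op i j :: _ \<Rightarrow> 'k xpol)"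
    and entry_sum_L_diag: "entry_sum J p q (L_op i i :: _ \<Rightarrow> 'k xpol)
      = (-1) ^ (i + 1) * (entry_sum J p q (row_op 1 1 :: _ \<Rightarrow> 'k xpol) - entry_sum J p q (col_op i i :: _ \<Rightarrow> 'k xpol))"
  by (simp_all only: entry_sum_def linear_coeff_B_op linear_coeff_L_op if_True if_False simp_thms
      sum_subtractf sum_distrib_left right_diff_distrib)

text \<open>
  A generator off the diagonal is detected by one entry. The remaining generators multiply each
  variable \<open>x\<^bsub>k,l\<^esub>\<close> by a scalar \<open>\<alpha>\<^sub>k +
  \<beta>\<^sub>l\<close>, and the functionals sum these scalars over a set \<open>S\<close> of
  positions with prescribed numbers of elements in each row and column. At these positions the
  generators off the diagonal vanish. The functional kills every \<open>B\<^sub>l\<close> for which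
  rows \<open>l\<close> and \<open>1\<close> contain equally many elements of \<open>S\<close>, and
  every \<open>L\<^bsub>i,i\<^esub>\<close> for which row \<open>1\<close> and column
  \<open>i\<close> do. For \<open>B\<^sub>m\<close> each column and each row contain one element,
  except for two in row \<open>m\<close>; for \<open>L\<^bsub>i,i\<^esub>\<close> each row and each
  column contain one, except for none in column \<open>i\<close>.
\<close>

lemma dual_functional:
  assumes "n \<ge> 2" "A\<^sub>0 \<in> (generators n :: (nat \<times> nat \<Rightarrow> 'k::field xpol) set)"
  obtains J p q where "finite J" "\<And>t. t \<in> J \<Longrightarrow> p t \<in> entries n" "entry_sum J p q A\<^sub>0 \<noteq> 0"
    "\<And>A. A \<in> generators n \<Longrightarrow> A \<noteq> A\<^sub>0 \<Longrightarrow> entry_sum J p q A = 0"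
  using assms(2)
proof (cases rule: generators_cases)
  case (V r s)
  define e where "e = (entry_sum {0} (\<lambda>_. (s, 1)) (\<lambda>_. (r, 1)) :: _ \<Rightarrow> 'k)"
  note e_simps = entry_sum_generators[where 'k = 'k and J = "{0}" and p = "(\<lambda>_. (s, 1))" and q = "(\<lambda>_. (r, 1))", folded e_def]
  have row: "e (row_op r' s') = (if r' = r \<and> s' = s then 1 else 0)" for r' s'
    by (auto simp: e_def entry_sum_def linear_coeff_row_op)
  have col: "e (col_op i j) = 0" for i j
    using V by (auto simp: e_def entry_sum_def linear_coeff_col_op)
  show ?thesis
  proof (rule that[of "{0}" "(\<lambda>_. (s, 1))" "(\<lambda>_. (r, 1))", folded e_def])
    fix A :: "nat \<times> nat \<Rightarrow> 'k xpol" assume "A \<in> generators n" "A \<noteq> A\<^sub>0"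
    then show "e A = 0"
    proof (cases rule: generators_cases)
      case (L i j)
      then show ?thesis using V
        by (cases "i = j") (auto simp: e_simps row col simp del: One_nat_def)
    qed (use V in \<open>auto simp: row e_simps simp del: One_nat_def\<close>)
  qed (use V in \<open>auto simp: row simp del: One_nat_def\<close>)
next
  case (B m)
  \<comment> \<open>The diagonal positions \<open>(t, t)\<close> and \<open>(m, n + 1)\<close>.\<close>
  let ?\<rho> = "\<lambda>t. if t = n + 1 then m else t"
  let ?p = "\<lambda>t. (?\<rho> t, t)"
  define e where "e = (entry_sum {1..n+1} ?p ?p :: _ \<Rightarrow> 'k)"
  note e_simps = entry_sum_generators[where 'k = 'k and J = "{1..n+1}" and p = "?p" and q = "?p", folded e_def]
  have offdiag_row: "e (row_op r s) = 0" if "r \<noteq> s" for r s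
    using that unfolding e_def entry_sum_def linear_coeff_row_op by (intro sum.neutral) auto
  have offdiag_col: "e (col_op i j) = 0" if "i \<noteq> j" for i j
    using that unfolding e_def entry_sum_def linear_coeff_col_op by (intro sum.neutral) auto
  have row: "e (row_op r r) = (if r = m then 2 else 1)" if r: "r \<in> {1..n}" for r
  proof -
    have "e (row_op r r) = (\<Sum>t = 1..n. if t = r then 1 else 0) + (if m = r then 1 else 0)"
      unfolding e_def entry_sum_def linear_coeff_row_op by (auto simp: sum.cl_ivl_Suc intro!: sum.cong)
    then show ?thesis using r by auto
  qed
  have col: "e (col_op i i) = 1" if i: "i \<in> {1..n+1}" for i
  proof -
    have "e (col_op i i) = (\<Sum>t = 1..n+1. if t = i then 1 else 0)"
      unfolding e_def entry_sum_def linear_coeff_col_op by (intro sum.cong) auto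
    then show ?thesis using i by simp
  qed
  have B_value: "e (B_op l) = (if l = m then 1 else 0)" if "l \<in> {2..n}" for l
    using that B assms(1) by (simp add: e_simps row)
  show ?thesis
  proof (rule that[of "{1..n+1}" "?p" "?p", folded e_def])
    fix A :: "nat \<times> nat \<Rightarrow> 'k xpol" assume A: "A \<in> generators n" "A \<noteq> A\<^sub>0"
    from A(1) show "e A = 0"
    proof (cases rule: generators_cases)
      case (B l)
      then show ?thesis using A(2) \<open>A\<^sub>0 = B_op m\<close> B_value by auto
    next
      case (L i j)
      then show ?thesis using B assms(1)
        by (cases "i = j") (simp_all add: e_simps row col offdiag_col)
    qed (simp add: offdiag_row)
  qed (use B assms(1) B_value in auto)
next
  case (L i\<^sub>0 j\<^sub>0)
  show ?thesis
  proof (cases "i\<^sub>0 = j\<^sub>0")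
    case False
    define e where "e = (entry_sum {0} (\<lambda>_. (1, i\<^sub>0)) (\<lambda>_. (1, j\<^sub>0)) :: _ \<Rightarrow> 'k)"
    note e_simps = entry_sum_generators[where 'k = 'k and J = "{0}" and p = "(\<lambda>_. (1, i\<^sub>0))" and q = "(\<lambda>_. (1, j\<^sub>0))", folded e_def]
    have row: "e (row_op r s) = 0" for r s
      using False by (auto simp: e_def entry_sum_def linear_coeff_row_op)
    have col: "e (col_op i j) = (if i = i\<^sub>0 \<and> j = j\<^sub>0 then 1 else 0)" for i j
      by (auto simp: e_def entry_sum_def linear_coeff_col_op)
    show ?thesis
    proof (rule that[of "{0}" "(\<lambda>_. (1, i\<^sub>0))" "(\<lambda>_. (1, j\<^sub>0))", folded e_def])
      fix A :: "nat \<times> nat \<Rightarrow> 'k xpol" assume "A \<in> generators n" "A \<noteq> A\<^sub>0"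
      then show "e A = 0"
      proof (cases rule: generators_cases)
        case (L i j)
        then show ?thesis using \<open>A \<noteq> A\<^sub>0\<close> \<open>A\<^sub>0 = L_op i\<^sub>0 j\<^sub>0\<close> False
          by (cases "i = j") (auto simp: e_simps row col simp del: One_nat_def)
      qed (auto simp: row e_simps)
    qed (use L False assms(1) in \<open>auto simp: col e_simps\<close>)
  next
    case True
    \<comment> \<open>The increasing bijection from the rows to the columns other than \<open>i\<^sub>0\<close>.\<close>
    let ?c = "\<lambda>k. if k < i\<^sub>0 then k else k + 1"
    let ?p = "\<lambda>k. (k, ?c k)"
    define e where "e = (entry_sum {1..n} ?p ?p :: _ \<Rightarrow> 'k)"
    note e_simps = entry_sum_generators[where 'k = 'k and J = "{1..n}" and p = "?p" and q = "?p", folded e_def]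
    have offdiag_row: "e (row_op r s) = 0" if "r \<noteq> s" for r s
      using that unfolding e_def entry_sum_def linear_coeff_row_op by (intro sum.neutral) auto
    have offdiag_col: "e (col_op i j) = 0" if "i \<noteq> j" for i j
      using that unfolding e_def entry_sum_def linear_coeff_col_op by (intro sum.neutral) auto
    have row: "e (row_op r r) = 1" if r: "r \<in> {1..n}" for r
    proof -
      have "e (row_op r r) = (\<Sum>k = 1..n. if k = r then 1 else 0)"
        unfolding e_def entry_sum_def linear_coeff_row_op by (intro sum.cong) auto
      then show ?thesis using r by simp
    qed
    have col: "e (col_op i i) = (if i = i\<^sub>0 then 0 else 1)" if i: "i \<in> {1..n+1}" for i
    proof -
      have "e (col_op i i) = (\<Sum>k = 1..n. if ?c k = i then 1 else 0)"
        unfolding e_def entry_sum_def linear_coeff_col_op by (intro sum.cong) auto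
      also have "\<dots> = (\<Sum>k = 1..n. if k = (if i < i\<^sub>0 then i else i - 1) \<and> i \<noteq> i\<^sub>0 then 1 else 0)"
        using i by (intro sum.cong refl if_cong) auto
      finally show ?thesis using i L by auto
    qed
    show ?thesis
    proof (rule that[of "{1..n}" "?p" "?p", folded e_def])
      fix A :: "nat \<times> nat \<Rightarrow> 'k xpol" assume A: "A \<in> generators n" "A \<noteq> A\<^sub>0"
      from A(1) show "e A = 0"
      proof (cases rule: generators_cases)
        case (B l)
        then show ?thesis using assms(1) by (simp add: e_simps row)
      next
        case (L i j)
        then have "i = j \<Longrightarrow> i \<noteq> i\<^sub>0" using A(2) True \<open>A\<^sub>0 = L_op i\<^sub>0 j\<^sub>0\<close> by auto
        then show ?thesis using L assms(1)
          by (cases "i = j") (simp_all add: e_simps row col offdiag_col)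
      qed (simp add: offdiag_row)
    qed (use L True assms(1) in \<open>auto simp: e_simps row col\<close>)
  qed
qed

text \<open>
  Let the derivation induced by the generator \<open>A\<^sub>0\<close> be missing from
  \<open>T\<close>. The derivations that have a lift whose values on the variables have no constant
  terms, and whose linear parts are killed by the functional of \<open>A\<^sub>0\<close>, form a
  submodule: multiplication by \<open>g\<close> scales these linear parts by the constant term of
  \<open>g\<close>. It contains \<open>T\<close>, but not the missing derivation, since the
  coefficients of two lifts of a derivation differ by elements of \<open>I_ideal n\<close>, which
  have no linear terms.
\<close>

theorem generators_minimal:
  assumes n: "n \<ge> 2"
    and T: "T \<subset> gen.induced n ` (generators n :: (nat \<times> nat \<Rightarrow> 'k::field xpol) set)"
  shows "LinearCombinations.module.span (gen.R n) (Der (gen.R n) (gen.scal n)) T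
    \<noteq> derivations (gen.R n) (gen.scal n)"
proof
  let ?Q = "mpoly_ring (entries n) :: 'k xpol ring"
  let ?M = "Der (gen.R n) (gen.scal n :: 'k \<Rightarrow> _)"
  interpret M: module "gen.R n" ?M by (rule gen.module_Der_R)
  note log = logarithmic_generators[OF order_trans[OF one_le_numeral n]]
  assume span: "M.span T = derivations (gen.R n) (gen.scal n)"
  obtain A\<^sub>0 where A\<^sub>0: "A\<^sub>0 \<in> generators n" "gen.induced n A\<^sub>0 \<notin> T" using T by blast
  obtain J p q where J: "finite J" "\<And>t. t \<in> J \<Longrightarrow> p t \<in> entries n" "entry_sum J p q A\<^sub>0 \<noteq> 0"
    and vanish: "\<And>A. A \<in> generators n \<Longrightarrow> A \<noteq> A\<^sub>0 \<Longrightarrow> entry_sum J p q A = 0"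
    by (rule dual_functional[OF n A\<^sub>0(1)]) (rule that)
  define K where "K = {gen.induced n A | A. gen.logarithmic n A
    \<and> (\<forall>v. Poly_Mapping.lookup (A v) 0 = (0 :: 'k)) \<and> entry_sum J p q A = 0}"
  have KI: "gen.induced n A \<in> K"
    if "gen.logarithmic n A" "\<And>v. Poly_Mapping.lookup (A v) 0 = (0 :: 'k)" "entry_sum J p q A = 0" for A
    using that by (auto simp: K_def)
  have "submodule (gen.R n) K ?M"
  proof
    show "K \<subseteq> carrier ?M" using gen.induced_in_Der by (auto simp: K_def)
    show "\<zero>\<^bsub>?M\<^esub> \<in> K"
      using KI[of "\<lambda>_. 0"] by (simp add: gen.logarithmic_zero gen.induced_zero entry_sum_def del: Der_simps)
    fix \<delta> assume "\<delta> \<in> K"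
    then obtain A where A: "\<delta> = gen.induced n A" "gen.logarithmic n A"
      "\<And>v. Poly_Mapping.lookup (A v) 0 = 0" "entry_sum J p q A = 0" unfolding K_def by blast
    {
      fix \<epsilon> assume "\<epsilon> \<in> K"
      then obtain B where B: "\<epsilon> = gen.induced n B" "gen.logarithmic n B"
        "\<And>v. Poly_Mapping.lookup (B v) 0 = 0" "entry_sum J p q B = 0" unfolding K_def by blast
      have "gen.induced n (\<lambda>v. A v + B v) \<in> K"
        using A B by (intro KI gen.logarithmic_add) (simp_all add: lookup_add entry_sum_def sum.distrib)
      then show "\<delta> \<oplus>\<^bsub>?M\<^esub> \<epsilon> \<in> K" using A B by (simp only: gen.induced_add)
    }
    fix C assume "C \<in> carrier (gen.R n :: 'k xpol set ring)"
    then obtain g where g: "g \<in> carrier ?Q" "C = gen.cls n g" by (rule gen.carrier_RE)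
    have "entry_sum J p q (\<lambda>v. g * A v) = Poly_Mapping.lookup g 0 * entry_sum J p q A"
      by (simp add: entry_sum_def linear_coeff_mult A(3) sum_distrib_left)
    then have "gen.induced n (\<lambda>v. g * A v) \<in> K"
      using A g by (intro KI gen.logarithmic_smult) (simp_all add: lookup_zero_mult)
    then show "C \<odot>\<^bsub>?M\<^esub> \<delta> \<in> K" using A g by (simp only: gen.induced_smult)
  qed
  moreover have "T \<subseteq> K"
  proof
    fix \<delta> assume "\<delta> \<in> T"
    then obtain A where A: "A \<in> generators n" "\<delta> = gen.induced n A" using T by blast
    then have "A \<noteq> A\<^sub>0" using \<open>\<delta> \<in> T\<close> A\<^sub>0(2) by blast
    then show "\<delta> \<in> K" using A vanish by (simp add: KI log lookup_zero_generator)
  qed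
  ultimately have "M.span T \<subseteq> K" by (intro M.span_is_subset)
  then have "gen.induced n A\<^sub>0 \<in> K"
    using gen.induced_in_Der[OF log[OF A\<^sub>0(1)]] unfolding span by blast
  then obtain A where A: "gen.induced n A\<^sub>0 = gen.induced n A" "gen.logarithmic n A"
    "entry_sum J p q A = 0" unfolding K_def by blast
  have "linear_coeff u (A\<^sub>0 v) = linear_coeff u (A v)" if v: "v \<in> entries n" for u v
  proof -
    have val: "gen.induced n B (gen.cls n (Var v)) = gen.cls n (B v)" if "gen.logarithmic n B" for B
      using gen.induced_cls[OF that, of "Var v"] v gen.finite_W by (simp add: vector_field_Var)
    have "gen.cls n (A\<^sub>0 v) = gen.cls n (A v)"
      using val[OF A(2)] val[OF log[OF A\<^sub>0(1)]] A(1) by simp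
    then have "A\<^sub>0 v - A v \<in> I_ideal n"
      using gen.cls_eq_iff gen.logarithmicD(2)[OF A(2) v] gen.logarithmicD(2)[OF log[OF A\<^sub>0(1)] v]
      by blast
    from I_ideal_order_two(2)[OF n this, of u] show ?thesis by simp
  qed
  then have "entry_sum J p q A\<^sub>0 = entry_sum J p q A"
    unfolding entry_sum_def by (intro sum.cong refl) (use J(2) in auto)
  then show False using A(3) J(3) by simp
qed

theorem corollary6p4:
  fixes n :: nat
  assumes "n \<ge> 2"
  shows "minimal_generating_set (R_ring n :: 'k::field xpol set ring) (Der_R n)
    (induced_R n `
      ({V_der n r s | r s. r \<in> {1..n} \<and> s \<in> {1..n} \<and> r \<noteq> s}
       \<union> {B_der n l | l. l \<in> {2..n}}
       \<union> {L_der n i j | i j. i \<in> {1..n+1} \<and> j \<in> {1..n+1}}))"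
proof -
  have n: "n \<ge> 1" using assms by simp
  have "gen.induced n ` generators n \<subseteq> derivations (gen.R n) (gen.scal n :: 'k \<Rightarrow> _)"
    using gen.induced_in_Der[OF logarithmic_generators[OF n]] by blast
  then show ?thesis
    unfolding minimal_generating_set_def induced_generators[OF n] R_ring_eq Der_R_eq Der_simps(1)
    using generators_span[OF n] generators_minimal[OF assms] by blast
qed

end
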